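(* Let $k\in\{3,4,5\}$ and $\epsilon\in(0,1)$. Assume that the starting values $\phi^1,\dots,\phi^{k-1}$ preserve the volume, i.e. $\langle\phi^\ell,1\rangle=\langle\phi^0,1\rangle$ for $1\le\ell\le k-1$, and that the time-step size satisfies $$\tau\le\frac{2}{3\epsilon}\min\{b_0^{(k)},\sigma_{Lk}\}.$$ Then the BDF-$k$ implicit scheme $$D_k\phi^n=\Delta\mu^n,\qquad \mu^n=(1+\Delta)^2\phi^n+(\phi^n)^3-\epsilon\phi^n,\qquad k\le n\le N,$$ with periodic boundary conditions on $\Omega$, preserves the energy dissipation law $$\mathcal{E}_k[\vec\phi^n]\le\mathcal{E}_k[\vec\phi^{n-1}]\qquad\text{for } k\le n\le N.$$
   Context: Setting: $\Omega\subset\mathbb{R}^2$ is a bounded periodic cell; all functions are real-valued and $\Omega$-periodic. $\langle f,g\rangle=\int_\Omega fg\,d\mathbf{x}$, $\|f\|=\sqrt{\langle f,f\rangle}$. For mean-zero functions $v,w$ (i.e. $\langle v,1\rangle=\langle w,1\rangle=0$), $\langle v,w\rangle_{-1}:=\langle(-\Delta)^{-1}v,w\rangle$ and $\|v\|_{-1}:=\sqrt{\langle v,v\rangle_{-1}}$. Only time is discretized: $t_n=n\tau$, $\tau=T/N$, $\phi^n$ approximates the solution at $t_n$; $\phi^0$ and the starting values $\phi^1,\dots,\phi^{k-1}$ are given. Notation: $\nabla_\tau v^n:=v^n-v^{n-1}$. The BDF-$k$ formula is $D_kv^n:=\frac1\tau\sum_{j=1}^nb_{n-j}^{(k)}\nabla_\tau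 v^j$ for $n\ge k$, where the kernels are defined by $\sum_{\ell=1}^{k}\frac1\ell(1-\zeta)^{\ell-1}=\sum_{\ell=0}^{k-1}b_\ell^{(k)}\zeta^\ell$ and $b_j^{(k)}:=0$ for $j\ge k$; in particular $b_0^{(3)}=\frac{11}6$, $b_0^{(4)}=\frac{25}{12}$, $b_0^{(5)}=\frac{137}{60}$. Constants: $\sigma_{L3}=\frac{95}{48}$, $\sigma_{L4}=\frac{4919}{3072}$, $\sigma_{L5}=\frac{646631}{1920000}$. Quadratic functionals (with $\delta_1v_n:=v_n-v_{n-1}$ and $\vec v_n:=(v_n,v_{n-1},\dots)$): $\mathcal{G}_3[\vec v_n]=\frac16v_n^2+\frac16(\frac74v_n-v_{n-1})^2$; $\mathcal{G}_4[\vec v_n]=\frac{13627}{43008}v_n^2+\frac7{24}(\frac{65}{56}v_n-v_{n-1})^2+\frac18(\frac32\delta_1v_n+v_{n-2})^2$; $\mathcal{G}_5[\vec v_n]=\frac{1198850903}{1678080000}v_n^2+\frac{437}{900}(\frac{4931}{6992}v_n-v_{n-1})^2+\frac9{40}(\frac{23}{18}\delta_1v_n+v_{n-2})^2+\frac1{10}(2\delta_1v_n+2v_{n-2}-v_{n-3})^2$. $\langle\mathcal{G}_k[\nabla_\tau\vec\phi^n],1\rangle_{-1}$ denotes the expression obtained from $\mathcal{G}_k[\vec v_n]$ by substituting $v_m=\nabla_\tau\phi^m$ and replacing each square $(\cdot)^2$ by $\|\cdot\|_{-1}^2$ (equivalently, each product by the inner product $\langle\cdot,\cdot\rangle_{-1}$).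 Energies: $E[\phi^n]:=\frac12\|(1+\Delta)\phi^n\|^2+\frac14\|(\phi^n)^2-\epsilon\|^2-\frac14\|\epsilon\|^2$, and the modified discrete energy is $\mathcal{E}_k[\vec\phi^n]:=E[\phi^n]+\frac1\tau\langle\mathcal{G}_k[\nabla_\tau\vec\phi^n],1\rangle_{-1}$ for $n\ge k-1$. *)

theory Defs
  imports "HOL-Analysis.Analysis" "HOL-Computational_Algebra.Polynomial"
begin

type_synonym field2 = "real ^ 2 \<Rightarrow> real"

section \<open>Periodic functions on a cell\<close>

text \<open>The columns of \<open>P\<close> span the period lattice, and \<open>\<Omega>\<close> is a closed fundamental parallelogram
  of it with an arbitrary corner. A rectangular cell is the case of a diagonal \<open>P\<close>. Including the
  boundary does not affect the integrals.\<close>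

definition periodic_cell :: "real ^ 2 ^ 2 \<Rightarrow> (real ^ 2) set \<Rightarrow> bool" where
  "periodic_cell P \<Omega> \<longleftrightarrow>
     invertible P \<and> (\<exists>c. \<Omega> = (\<lambda>s. c + P *v s) ` {s. \<forall>i. 0 \<le> s $ i \<and> s $ i \<le> 1})"

definition periodic :: "real ^ 2 ^ 2 \<Rightarrow> field2 \<Rightarrow> bool" where
  "periodic P f \<longleftrightarrow> (\<forall>x i. f (x + column i P) = f x)"

definition partial :: "2 \<Rightarrow> field2 \<Rightarrow> field2" where
  "partial i f x = frechet_derivative f (at x) (axis i 1)"

primrec C_class :: "nat \<Rightarrow> field2 \<Rightarrow> bool" where
  "C_class 0 f \<longleftrightarrow> continuous_on UNIV f"
| "C_class (Suc m) f \<longleftrightarrow> (\<forall>x. f differentiable (at x)) \<and> (\<forall>i. C_class m (partial i f))"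

definition laplacian :: "field2 \<Rightarrow> field2" where
  "laplacian f x = (\<Sum>i\<in>UNIV. partial i (partial i f) x)"

definition one_plus_laplacian :: "field2 \<Rightarrow> field2" where
  "one_plus_laplacian f x = f x + laplacian f x"


section \<open>Inner products and norms\<close>

definition inner_L2 :: "(real ^ 2) set \<Rightarrow> field2 \<Rightarrow> field2 \<Rightarrow> real" where
  "inner_L2 \<Omega> f g = integral \<Omega> (\<lambda>x. f x * g x)"

definition norm_L2 :: "(real ^ 2) set \<Rightarrow> field2 \<Rightarrow> real" where
  "norm_L2 \<Omega> f = sqrt (inner_L2 \<Omega> f f)"

text \<open>The inverse of the negative Laplacian takes values in the mean-zero functions. It is meaningful when
  \<open>v\<close> is periodic, has mean zero and is regular enough for a classical solution to exist; \<open>C_class 2\<close>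
  is sufficient.\<close>

definition inv_neg_laplacian :: "real ^ 2 ^ 2 \<Rightarrow> (real ^ 2) set \<Rightarrow> field2 \<Rightarrow> field2" where
  "inv_neg_laplacian P \<Omega> v =
     (THE \<psi>. periodic P \<psi> \<and> C_class 2 \<psi> \<and> inner_L2 \<Omega> \<psi> (\<lambda>_. 1) = 0 \<and>
             (\<forall>x. - laplacian \<psi> x = v x))"

definition inner_m1 :: "real ^ 2 ^ 2 \<Rightarrow> (real ^ 2) set \<Rightarrow> field2 \<Rightarrow> field2 \<Rightarrow> real" where
  "inner_m1 P \<Omega> v w = inner_L2 \<Omega> (inv_neg_laplacian P \<Omega> v) w"

definition norm_m1 :: "real ^ 2 ^ 2 \<Rightarrow> (real ^ 2) set \<Rightarrow> field2 \<Rightarrow> real" where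
  "norm_m1 P \<Omega> v = sqrt (inner_m1 P \<Omega> v v)"


section \<open>The BDF formulas\<close>

definition bdf_kernel :: "nat \<Rightarrow> nat \<Rightarrow> real" where
  "bdf_kernel k j = coeff (\<Sum>l = 1..k. smult (1 / real l) ([:1, - 1:] ^ (l - 1))) j"

definition nabla_tau :: "(nat \<Rightarrow> field2) \<Rightarrow> nat \<Rightarrow> field2" where
  "nabla_tau v n x = v n x - v (n - 1) x"

definition BDF :: "nat \<Rightarrow> real \<Rightarrow> (nat \<Rightarrow> field2) \<Rightarrow> nat \<Rightarrow> field2" where
  "BDF k \<tau> v n x = 1 / \<tau> * (\<Sum>j = 1..n. bdf_kernel k (n - j) * nabla_tau v j x)"

text \<open>The value for \<open>k \<notin> {3, 4, 5}\<close> is irrelevant here and for \<open>G_functional\<close>.\<close>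

definition sigma_L :: "nat \<Rightarrow> real" where
  "sigma_L k =
    (if k = 3 then 95 / 48
     else if k = 4 then 4919 / 3072
     else if k = 5 then 646631 / 1920000
     else 0)"


section \<open>Energies\<close>

text \<open>The quadratic functionals, with the operation \<open>sq\<close> in place of squaring.\<close>

definition G_functional :: "nat \<Rightarrow> (field2 \<Rightarrow> real) \<Rightarrow> (nat \<Rightarrow> field2) \<Rightarrow> nat \<Rightarrow> real" where
  "G_functional k sq v n =
    (if k = 3 then
        1 / 6 * sq (v n)
      + 1 / 6 * sq (\<lambda>x. 7 / 4 * v n x - v (n - 1) x)
     else if k = 4 then
        13627 / 43008 * sq (v n)
      + 7 / 24 * sq (\<lambda>x. 65 / 56 * v n x - v (n - 1) x)
      + 1 / 8 * sq (\<lambda>x. 3 / 2 * (v n x - v (n - 1) x) + v (n - 2) x)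
     else if k = 5 then
        1198850903 / 1678080000 * sq (v n)
      + 437 / 900 * sq (\<lambda>x. 4931 / 6992 * v n x - v (n - 1) x)
      + 9 / 40 * sq (\<lambda>x. 23 / 18 * (v n x - v (n - 1) x) + v (n - 2) x)
      + 1 / 10 * sq (\<lambda>x. 2 * (v n x - v (n - 1) x) + 2 * v (n - 2) x - v (n - 3) x)
     else 0)"

definition energy :: "(real ^ 2) set \<Rightarrow> real \<Rightarrow> field2 \<Rightarrow> real" where
  "energy \<Omega> \<epsilon> f =
     1 / 2 * (norm_L2 \<Omega> (one_plus_laplacian f))\<^sup>2
   + 1 / 4 * (norm_L2 \<Omega> (\<lambda>x. (f x)\<^sup>2 - \<epsilon>))\<^sup>2
   - 1 / 4 * (norm_L2 \<Omega> (\<lambda>x. \<epsilon>))\<^sup>2"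

definition modified_energy ::
  "real ^ 2 ^ 2 \<Rightarrow> (real ^ 2) set \<Rightarrow> real \<Rightarrow> nat \<Rightarrow> real \<Rightarrow> (nat \<Rightarrow> field2) \<Rightarrow> nat \<Rightarrow> real" where
  "modified_energy P \<Omega> \<epsilon> k \<tau> \<phi> n =
     energy \<Omega> \<epsilon> (\<phi> n)
   + 1 / \<tau> * G_functional k (\<lambda>v. (norm_m1 P \<Omega> v)\<^sup>2) (nabla_tau \<phi>) n"

end

theory Submission
  imports Defs
begin

text \<open>
  Pairing the scheme at level \<open>n\<close> with the potential of the increment \<open>v\<^sub>n = \<phi>\<^sub>n - \<phi>\<^sub>n\<^sub>-\<^sub>1\<close>, that is with
  the solution \<open>\<psi>\<close> of the Poisson equation with right-hand side \<open>v\<^sub>n\<close>, turns it into the identity that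
  the H^-1 inner product of the BDF difference with \<open>v\<^sub>n\<close> equals minus the integral of \<open>\<mu>\<^sub>n v\<^sub>n\<close>.
  Each side carries an energy difference.

  On the left, \<open>bdf_gradient_structure\<close> splits off the difference of the quadratic functionals and
  the dissipation \<open>\<sigma> / 2\<close> times the squared H^-1 norm of \<open>v\<^sub>n\<close>, up to a sum of squares. This is
  algebra in the Gram matrix of the last increments. On the right, \<open>energy_difference_le\<close> bounds the
  difference of the energies \<open>E\<close> by the integral of \<open>\<mu>\<^sub>n v\<^sub>n\<close>, minus half the squared norm of
  \<open>(1 + \<Delta>) v\<^sub>n\<close>, plus \<open>\<epsilon> / 2\<close> times the squared norm of \<open>v\<^sub>n\<close>; only the last term, which comes from
  the concave part of the energy, has the wrong sign. After division by \<open>\<tau>\<close>, the step size condition makes the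
  dissipation at least \<open>3 * \<epsilon> / 4\<close> times the squared H^-1 norm, and since \<open>\<epsilon> < 1\<close> the bad term is then absorbed
  by \<open>norm_L2_sq_le_m1_plus_laplacian\<close>, an interpolation inequality.

  The H^-1 inner product is defined through the solution of a Poisson equation, so its bilinearity,
  symmetry and positivity rest on existence and uniqueness of that solution. Uniqueness is
  \<open>harmonic_imp_constant\<close>. Existence (\<open>poisson_solvable\<close>) has to hold for every twice continuously
  differentiable periodic field of mean zero, because the starting values are arbitrary. It is
  obtained from averages over discs. If \<open>A\<close> averages over a disc with a suitable radial weight, then
  \<open>A - 1 = \<Delta> B\<close> for another averaging operator \<open>B\<close> (\<open>laplacian_ball_potential\<close>). If the disc
  is large enough to contain the period cell well inside, then \<open>A\<close> is a strict contraction on mean-zero fields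
  (\<open>ball_average_contraction\<close>). Hence the sum of \<open>B A\<^sup>m v\<close> over all \<open>m\<close> converges and solves the Poisson
  equation with right-hand side \<open>v\<close>.
\<close>

section \<open>Partial derivatives and the classes of smooth fields\<close>

lemma sum_axis_components: "(\<Sum>i\<in>UNIV. (h $ i) *\<^sub>R axis i (1::real)) = (h :: real ^ 2)"
  by (simp add: vec_eq_iff axis_def if_distrib cong: if_cong)

lemma has_derivative_partial:
  assumes "f differentiable (at x)"
  shows "(f has_derivative (\<lambda>h. \<Sum>i\<in>UNIV. h $ i * partial i f x)) (at x)"
proof -
  let ?D = "frechet_derivative f (at x)"
  have D: "(f has_derivative ?D) (at x)"
    using assms frechet_derivative_works by blast
  then have lin: "linear ?D"
    by (rule has_derivative_linear)
  have "?D h = (\<Sum>i\<in>UNIV. h $ i * partial i f x)" for h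
  proof -
    have "?D (\<Sum>i\<in>UNIV. (h $ i) *\<^sub>R axis i 1) = (\<Sum>i\<in>UNIV. h $ i * partial i f x)"
      using lin by (simp add: linear_sum linear_scale partial_def)
    then show ?thesis
      by (simp add: sum_axis_components)
  qed
  then have "?D = (\<lambda>h. \<Sum>i\<in>UNIV. h $ i * partial i f x)"
    by (rule ext)
  with D show ?thesis
    by simp
qed

text \<open>The existence of the Frechet derivative has to be established once for each construction below
  (combinations, products, shifts, integrals, series); reading off its coordinates then gives the
  partial derivatives.\<close>

lemma partialI:
  assumes "(f has_derivative (\<lambda>h. \<Sum>i\<in>UNIV. h $ i * g i)) (at x)"
  shows "f differentiable (at x)" and "partial i f x = g i"
proof -
  show "f differentiable (at x)"
    using assms by (rule differentiableI)
  have "frechet_derivative f (at x) = (\<lambda>h. \<Sum>i\<in>UNIV. h $ i * g i)"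
    using frechet_derivative_at[OF assms] by simp
  then show "partial i f x = g i"
    by (simp add: partial_def axis_def if_distrib if_distribR cong: if_cong)
qed

lemma has_derivative_line:
  assumes "f differentiable (at (x + h *\<^sub>R axis i 1))"
  shows "((\<lambda>h. f (x + h *\<^sub>R axis i 1)) has_field_derivative partial i f (x + h *\<^sub>R axis i 1)) (at h)"
proof -
  have "((\<lambda>h. x + h *\<^sub>R axis i 1) has_derivative (\<lambda>t. t *\<^sub>R axis i 1)) (at h)"
    by (auto intro!: derivative_eq_intros)
  from diff_chain_at[OF this has_derivative_partial[OF assms]]
  have "((\<lambda>h. f (x + h *\<^sub>R axis i 1)) has_derivative
      (\<lambda>t. \<Sum>j\<in>UNIV. (t *\<^sub>R axis i 1 :: real^2) $ j * partial j f (x + h *\<^sub>R axis i 1))) (at h)"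
    by (simp add: o_def)
  moreover have "(\<Sum>j\<in>UNIV. (t *\<^sub>R axis i 1 :: real^2) $ j * partial j f (x + h *\<^sub>R axis i 1))
      = partial i f (x + h *\<^sub>R axis i 1) * t" for t
    by (simp add: axis_def if_distrib if_distribR mult.commute cong: if_cong)
  ultimately show ?thesis
    by (simp add: has_field_derivative_def)
qed

lemma C_class_continuous: "C_class m f \<Longrightarrow> continuous_on UNIV f"
  by (cases m) (auto simp: continuous_on_eq_continuous_within differentiable_imp_continuous_within)

lemma C_class_1_D:
  assumes "C_class 1 f"
  shows "f differentiable (at x)" "continuous_on UNIV f" "continuous_on UNIV (partial i f)"
  using C_class_continuous[OF assms] assms by auto

lemma C_class_Suc_D: "C_class (Suc m) f \<Longrightarrow> C_class m f"
  by (induction m arbitrary: f)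
     (auto simp: continuous_on_eq_continuous_within differentiable_imp_continuous_within)

lemma C_class_mono: "m \<le> n \<Longrightarrow> C_class n f \<Longrightarrow> C_class m f"
  by (induction n rule: dec_induct) (auto dest: C_class_Suc_D simp del: C_class.simps)

lemma C_class_partial: "C_class (Suc m) f \<Longrightarrow> C_class m (partial i f)"
  by simp

lemma partial_lincomb:
  assumes "f differentiable (at x)" "g differentiable (at x)"
  shows "(\<lambda>x. a * f x + b * g x) differentiable (at x)"
    and "partial i (\<lambda>x. a * f x + b * g x) x = a * partial i f x + b * partial i g x"
proof -
  have "((\<lambda>x. a * f x + b * g x) has_derivative
      (\<lambda>h. \<Sum>i\<in>UNIV. h $ i * (a * partial i f x + b * partial i g x))) (at x)"
    by (rule has_derivative_eq_rhs[OF has_derivative_add[OF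
          has_derivative_mult_right[OF has_derivative_partial[OF assms(1)]]
          has_derivative_mult_right[OF has_derivative_partial[OF assms(2)]]]])
       (simp add: fun_eq_iff sum.distrib sum_distrib_left algebra_simps)
  from partialI[OF this]
  show "(\<lambda>x. a * f x + b * g x) differentiable (at x)"
    "partial i (\<lambda>x. a * f x + b * g x) x = a * partial i f x + b * partial i g x"
    by blast+
qed

lemma partial_mult:
  assumes "f differentiable (at x)" "g differentiable (at x)"
  shows "(\<lambda>x. f x * g x) differentiable (at x)"
    and "partial i (\<lambda>x. f x * g x) x = partial i f x * g x + f x * partial i g x"
proof -
  have "((\<lambda>x. f x * g x) has_derivative
      (\<lambda>h. \<Sum>i\<in>UNIV. h $ i * (partial i f x * g x + f x * partial i g x))) (at x)"
    by (rule has_derivative_eq_rhs[OF has_derivative_mult[OF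
          has_derivative_partial[OF assms(1)] has_derivative_partial[OF assms(2)]]])
       (simp add: fun_eq_iff sum.distrib sum_distrib_left algebra_simps)
  from partialI[OF this]
  show "(\<lambda>x. f x * g x) differentiable (at x)"
    "partial i (\<lambda>x. f x * g x) x = partial i f x * g x + f x * partial i g x"
    by blast+
qed

lemma partial_const: "partial i (\<lambda>_. a) = (\<lambda>_. 0)"
  by (simp add: partial_def fun_eq_iff)

lemma C_class_const: "C_class m (\<lambda>_. a)"
  by (induction m arbitrary: a) (auto simp: partial_const)

lemma C_class_lincomb:
  "C_class m f \<Longrightarrow> C_class m g \<Longrightarrow> C_class m (\<lambda>x. a * f x + b * g x)"
proof (induction m arbitrary: f g)
  case 0
  then show ?case by (auto intro!: continuous_intros)
next
  case (Suc m)
  have "partial i (\<lambda>x. a * f x + b * g x) = (\<lambda>x. a * partial i f x + b * partial i g x)" for i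
    using Suc.prems by (simp add: fun_eq_iff partial_lincomb)
  with Suc show ?case
    by (simp add: partial_lincomb)
qed

lemma laplacian_lincomb:
  assumes "C_class 2 f" "C_class 2 g"
  shows "laplacian (\<lambda>x. a * f x + b * g x) x = a * laplacian f x + b * laplacian g x"
proof -
  have "partial i (\<lambda>x. a * f x + b * g x) = (\<lambda>x. a * partial i f x + b * partial i g x)" for i
    using assms by (simp add: numeral_2_eq_2 fun_eq_iff partial_lincomb)
  then show ?thesis
    using assms by (simp add: laplacian_def numeral_2_eq_2 partial_lincomb sum.distrib sum_distrib_left)
qed

lemma laplacian_const: "laplacian (\<lambda>_. a) x = 0"
  by (simp add: laplacian_def partial_const)

lemma C_class_laplacian: "C_class (Suc (Suc m)) f \<Longrightarrow> C_class m (laplacian f)"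
proof -
  assume f: "C_class (Suc (Suc m)) f"
  have "laplacian f = (\<lambda>x. 1 * partial 1 (partial 1 f) x + 1 * partial 2 (partial 2 f) x)"
    by (simp add: fun_eq_iff laplacian_def sum_2)
  with f show ?thesis
    by (simp only:) (intro C_class_lincomb, auto)
qed

section \<open>Differentiation under integrals and series\<close>

text \<open>A weighted average of translates of \<open>f\<close>: the parameter \<open>p\<close> ranges over a box of an arbitrary
  Euclidean space, which covers both averages over a disc (\<open>p\<close> is the displacement) and averages over
  a family of discs (\<open>p\<close> is a pair of a radius and a displacement). Since only the argument of \<open>f\<close> is
  translated, these operators commute with partial derivatives and preserve periodicity.\<close>

definition smear :: "'p::euclidean_space \<Rightarrow> 'p \<Rightarrow> ('p \<Rightarrow> real) \<Rightarrow> ('p \<Rightarrow> real ^ 2) \<Rightarrow> field2 \<Rightarrow> field2" where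
  "smear a b W \<sigma> f x = integral (cbox a b) (\<lambda>p. W p * f (x + \<sigma> p))"

lemma continuous_shifted:
  fixes f :: field2
  assumes "continuous_on UNIV f" "continuous_on A g"
  shows "continuous_on A (\<lambda>x. f (g x))"
  using assms by (rule continuous_on_compose2) auto

lemma continuous_smear:
  assumes W: "continuous_on (cbox a b) W" and s: "continuous_on (cbox a b) \<sigma>"
    and f: "continuous_on UNIV f"
  shows "continuous_on UNIV (smear a b W \<sigma> f)"
  unfolding smear_def
  by (rule integral_continuous_on_param)
     (auto simp: split_beta intro!: continuous_intros continuous_shifted[OF f]
        continuous_on_compose2[OF W] continuous_on_compose2[OF s])

lemma partial_smear:
  assumes W: "continuous_on (cbox a b) W" and s: "continuous_on (cbox a b) \<sigma>"
    and f: "C_class 1 f"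
  shows "smear a b W \<sigma> f differentiable (at x)"
    and "partial i (smear a b W \<sigma> f) x = smear a b W \<sigma> (partial i f) x"
proof -
  have diff: "\<And>x. f differentiable (at x)" and pc: "\<And>i. continuous_on UNIV (partial i f)"
    using f by auto
  have fc: "continuous_on UNIV f"
    using f by (rule C_class_continuous)
  define D where "D x p = (\<Sum>i\<in>UNIV. (W p * partial i f (x + \<sigma> p)) *\<^sub>R blinfun_inner_left (axis i (1::real) :: real^2))" for x p
  have "((\<lambda>x. integral (cbox a b) (\<lambda>p. W p * f (x + \<sigma> p))) has_derivative integral (cbox a b) (D x)) (at x within UNIV)"
  proof (rule leibniz_rule)
    show "((\<lambda>x. W t * f (x + \<sigma> t)) has_derivative blinfun_apply (D x t)) (at x within UNIV)" for x t
    proof -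
      have "((\<lambda>x. x + \<sigma> t) has_derivative (\<lambda>h. h)) (at x)"
        by (auto intro!: derivative_eq_intros)
      from has_derivative_mult_right[OF diff_chain_at[OF this has_derivative_partial[OF diff]], of "W t"]
      have "((\<lambda>x. W t * f (x + \<sigma> t)) has_derivative
          (\<lambda>h. \<Sum>i\<in>UNIV. W t * (h $ i * partial i f (x + \<sigma> t)))) (at x)"
        by (simp add: o_def sum_distrib_left)
      moreover have "blinfun_apply (D x t) = (\<lambda>h. \<Sum>i\<in>UNIV. W t * (h $ i * partial i f (x + \<sigma> t)))"
        by (simp add: fun_eq_iff D_def blinfun.sum_left blinfun.scaleR_left inner_axis ac_simps)
      ultimately show ?thesis
        by simp
    qed
    show "(\<lambda>p. W p * f (x + \<sigma> p)) integrable_on cbox a b" for x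
      by (intro integrable_continuous continuous_intros continuous_shifted[OF fc] W s)
    show "continuous_on (UNIV \<times> cbox a b) (\<lambda>(x, t). D x t)"
      unfolding D_def
      by (auto simp: split_beta intro!: continuous_intros continuous_shifted[OF pc]
        continuous_on_compose2[OF W] continuous_on_compose2[OF s])
  qed auto
  moreover have "blinfun_apply (integral (cbox a b) (D x)) h = (\<Sum>i\<in>UNIV. h $ i * smear a b W \<sigma> (partial i f) x)" for h
  proof -
    have int: "D x integrable_on cbox a b"
      unfolding D_def
      by (intro integrable_continuous continuous_intros continuous_shifted[OF pc] W s)
    have "blinfun_apply (integral (cbox a b) (D x)) h = integral (cbox a b) (\<lambda>p. blinfun_apply (D x p) h)"
      using integral_linear[OF int blinfun.bounded_linear_left[of h]] by (simp add: o_def)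
    also have "\<dots> = integral (cbox a b) (\<lambda>p. \<Sum>i\<in>UNIV. h $ i * (W p * partial i f (x + \<sigma> p)))"
      by (simp add: D_def blinfun.sum_left blinfun.scaleR_left inner_axis ac_simps)
    also have "\<dots> = (\<Sum>i\<in>UNIV. integral (cbox a b) (\<lambda>p. h $ i * (W p * partial i f (x + \<sigma> p))))"
      by (intro integral_sum integrable_continuous continuous_intros continuous_shifted[OF pc] W s) auto
    finally show ?thesis
      by (simp add: smear_def)
  qed
  then have "blinfun_apply (integral (cbox a b) (D x)) = (\<lambda>h. \<Sum>i\<in>UNIV. h $ i * smear a b W \<sigma> (partial i f) x)"
    by (rule ext)
  ultimately have "(smear a b W \<sigma> f has_derivative (\<lambda>h. \<Sum>i\<in>UNIV. h $ i * smear a b W \<sigma> (partial i f) x)) (at x)"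
    by (simp add: smear_def[abs_def])
  from partialI[OF this]
  show "smear a b W \<sigma> f differentiable (at x)"
    "partial i (smear a b W \<sigma> f) x = smear a b W \<sigma> (partial i f) x"
    by blast+
qed

lemma C_class_smear:
  assumes W: "continuous_on (cbox a b) W" and s: "continuous_on (cbox a b) \<sigma>"
  shows "C_class m f \<Longrightarrow> C_class m (smear a b W \<sigma> f)"
proof (induction m arbitrary: f)
  case 0
  then show ?case using continuous_smear[OF W s] by simp
next
  case (Suc m)
  have "C_class 1 f"
    using Suc.prems by (rule C_class_mono[rotated]) simp
  note ps = partial_smear[OF W s this]
  have "partial i (smear a b W \<sigma> f) = smear a b W \<sigma> (partial i f)" for i
    using ps(2) by (simp add: fun_eq_iff)
  with Suc ps(1) show ?case
    by simp
qed

lemma continuous_series: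
  fixes f :: "nat \<Rightarrow> field2"
  assumes "\<And>n. continuous_on UNIV (f n)" "\<And>n x. \<bar>f n x\<bar> \<le> a n" "summable a"
  shows "continuous_on UNIV (\<lambda>x. \<Sum>n. f n x)"
proof (rule uniform_limit_theorem)
  show "uniform_limit UNIV (\<lambda>n x. \<Sum>i<n. f i x) (\<lambda>x. \<Sum>n. f n x) sequentially"
    using assms by (intro Weierstrass_m_test) auto
  show "\<forall>\<^sub>F n in sequentially. continuous_on UNIV (\<lambda>x. \<Sum>i<n. f i x)"
    using assms(1) by (intro always_eventually allI continuous_intros) auto
qed auto

text \<open>Uniform summability of the partial derivatives makes the derivatives of the partial sums converge
  uniformly in the operator norm: a linear functional on the plane is bounded by twice its largest
  coordinate, whence the \<open>e / 2\<close> in the proof.\<close>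

lemma partial_series:
  fixes f :: "nat \<Rightarrow> field2"
  assumes diff: "\<And>n x. f n differentiable (at x)"
    and f: "\<And>n x. \<bar>f n x\<bar> \<le> a n" and p: "\<And>n i x. \<bar>partial i (f n) x\<bar> \<le> a n"
    and a: "summable a"
  shows "(\<lambda>x. \<Sum>n. f n x) differentiable (at x)"
    and "partial i (\<lambda>x. \<Sum>n. f n x) x = (\<Sum>n. partial i (f n) x)"
proof -
  have sf: "summable (\<lambda>n. f n x)" for x
    by (rule summable_comparison_test'[OF a]) (use f in auto)
  let ?p' = "\<lambda>i x. \<Sum>n. partial i (f n) x"
  have ul: "uniform_limit UNIV (\<lambda>n x. \<Sum>k<n. partial i (f k) x) (?p' i) sequentially" for i
    using p a by (intro Weierstrass_m_test) auto
  have "\<exists>g. \<forall>x\<in>UNIV. (\<lambda>n. f n x) sums (g x) \<and>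
      (g has_derivative (\<lambda>h. \<Sum>i\<in>UNIV. h $ i * ?p' i x)) (at x within UNIV)"
  proof (rule has_derivative_series)
    show "(f n has_derivative (\<lambda>h. \<Sum>i\<in>UNIV. h $ i * partial i (f n) x)) (at x within UNIV)" for n x
      using has_derivative_partial[OF diff] by simp
    show "\<forall>\<^sub>F n in sequentially. \<forall>x\<in>UNIV. \<forall>h::real^2.
        norm ((\<Sum>k<n. \<Sum>i\<in>UNIV. h $ i * partial i (f k) x) - (\<Sum>i\<in>UNIV. h $ i * ?p' i x)) \<le> e * norm h"
      if "e > 0" for e :: real
    proof -
      have "\<forall>\<^sub>F n in sequentially. \<forall>i. \<forall>x\<in>UNIV. dist (\<Sum>k<n. partial i (f k) x) (?p' i x) < e / 2"
      proof (rule eventually_all_finite)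
        show "\<forall>\<^sub>F n in sequentially. \<forall>x\<in>UNIV. dist (\<Sum>k<n. partial i (f k) x) (?p' i x) < e / 2" for i
          using ul[of i] half_gt_zero[OF that] unfolding uniform_limit_iff by blast
      qed
      then show ?thesis
      proof eventually_elim
        case (elim n)
        show ?case
        proof (intro ballI allI)
          fix x and h :: "real^2"
          have "(\<Sum>k<n. \<Sum>i\<in>UNIV. h $ i * partial i (f k) x) - (\<Sum>i\<in>UNIV. h $ i * ?p' i x)
             = (\<Sum>i\<in>UNIV. h $ i * ((\<Sum>k<n. partial i (f k) x) - ?p' i x))"
            by (subst sum.swap) (simp add: sum_distrib_left sum_subtractf algebra_simps)
          also have "norm \<dots> \<le> (\<Sum>i\<in>(UNIV::2 set). norm h * (e / 2))"
          proof (rule sum_norm_le)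
            fix i :: 2
            have "\<bar>(\<Sum>k<n. partial i (f k) x) - ?p' i x\<bar> \<le> e / 2"
              using elim by (simp add: dist_real_def less_imp_le)
            then show "norm (h $ i * ((\<Sum>k<n. partial i (f k) x) - ?p' i x)) \<le> norm h * (e / 2)"
              by (simp only: real_norm_def abs_mult) (intro mult_mono component_le_norm_cart; simp)
          qed
          finally show "norm ((\<Sum>k<n. \<Sum>i\<in>UNIV. h $ i * partial i (f k) x) - (\<Sum>i\<in>UNIV. h $ i * ?p' i x)) \<le> e * norm h"
            by (simp add: mult.commute)
        qed
      qed
    qed
    show "(\<lambda>n. f n 0) sums (\<Sum>n. f n 0)"
      using sf summable_sums by blast
  qed auto
  then obtain g where g: "\<And>x. (\<lambda>n. f n x) sums (g x)"
      "\<And>x. (g has_derivative (\<lambda>h. \<Sum>i\<in>UNIV. h $ i * ?p' i x)) (at x)"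
    by auto
  have "g = (\<lambda>x. \<Sum>n. f n x)"
    using g(1) sums_unique by blast
  with partialI[OF g(2)] show "(\<lambda>x. \<Sum>n. f n x) differentiable (at x)"
      "partial i (\<lambda>x. \<Sum>n. f n x) x = ?p' i x"
    by blast+
qed

section \<open>Averages over a period cell\<close>

text \<open>Translating the unit box by \<open>h\<close> along an axis moves a slab of width \<open>h\<close> out on one side and an
  equal slab in on the other, and periodicity identifies the two slabs.\<close>

lemma integral_unit_box_shift_small:
  fixes F :: "real ^ 2 \<Rightarrow> real"
  assumes F: "continuous_on UNIV F" and per: "\<And>s. F (s + axis i 1) = F s"
    and h: "0 \<le> h" "h \<le> 1"
  shows "integral (cbox 0 1) (\<lambda>s. F (s + h *\<^sub>R axis i 1)) = integral (cbox 0 1) F"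
proof -
  let ?e = "axis i 1 :: real ^ 2"
  have e: "?e \<in> Basis" by (simp add: axis_in_Basis_iff)
  have inner_e: "x \<bullet> ?e = x $ i" for x by (simp add: inner_axis)
  have int: "F integrable_on cbox a b" for a b
    by (intro integrable_continuous continuous_on_subset[OF F]) auto
  have "integral (cbox 0 1) (\<lambda>s. F (s + h *\<^sub>R ?e)) = integral (cbox (h *\<^sub>R ?e) (1 + h *\<^sub>R ?e)) F"
    using integral_shift_cbox[of "h *\<^sub>R ?e" "h *\<^sub>R ?e" "1 + h *\<^sub>R ?e" F] by simp
  also have "\<dots> = integral (cbox (h *\<^sub>R ?e) (1 + h *\<^sub>R ?e) \<inter> {x. x \<bullet> ?e \<le> 1}) F
      + integral (cbox (h *\<^sub>R ?e) (1 + h *\<^sub>R ?e) \<inter> {x. x \<bullet> ?e \<ge> 1}) F"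
    by (rule integral_split[OF int e])
  also have "cbox (h *\<^sub>R ?e) (1 + h *\<^sub>R ?e) \<inter> {x. x \<bullet> ?e \<le> 1} = cbox (h *\<^sub>R ?e) 1"
  proof -
    have "x \<in> cbox (h *\<^sub>R ?e) (1 + h *\<^sub>R ?e) \<inter> {x. x \<bullet> ?e \<le> 1} \<longleftrightarrow> x \<in> cbox (h *\<^sub>R ?e) 1" for x
      unfolding Int_iff mem_Collect_eq inner_e
      using h exhaust_2[of i] by (auto simp: mem_box_cart axis_def forall_2)
    then show ?thesis by blast
  qed
  also have "cbox (h *\<^sub>R ?e) (1 + h *\<^sub>R ?e) \<inter> {x. x \<bullet> ?e \<ge> 1} = cbox ?e (1 + h *\<^sub>R ?e)"
  proof -
    have "x \<in> cbox (h *\<^sub>R ?e) (1 + h *\<^sub>R ?e) \<inter> {x. x \<bullet> ?e \<ge> 1} \<longleftrightarrow> x \<in> cbox ?e (1 + h *\<^sub>R ?e)" for x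
      unfolding Int_iff mem_Collect_eq inner_e
      using h exhaust_2[of i] by (auto simp: mem_box_cart axis_def forall_2)
    then show ?thesis by blast
  qed
  also have "integral (cbox ?e (1 + h *\<^sub>R ?e)) F = integral (cbox 0 (1 + (h - 1) *\<^sub>R ?e)) F"
    using integral_shift_cbox[of ?e ?e "1 + h *\<^sub>R ?e" F] per by (simp add: algebra_simps)
  also have "cbox (h *\<^sub>R ?e) 1 = cbox 0 1 \<inter> {x. x \<bullet> ?e \<ge> h}"
  proof -
    have "x \<in> cbox (h *\<^sub>R ?e) 1 \<longleftrightarrow> x \<in> cbox 0 1 \<inter> {x. x \<bullet> ?e \<ge> h}" for x
      unfolding Int_iff mem_Collect_eq inner_e
      using h exhaust_2[of i] by (auto simp: mem_box_cart axis_def forall_2)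
    then show ?thesis by blast
  qed
  also have "cbox 0 (1 + (h - 1) *\<^sub>R ?e) = cbox 0 1 \<inter> {x. x \<bullet> ?e \<le> h}"
  proof -
    have "x \<in> cbox 0 (1 + (h - 1) *\<^sub>R ?e) \<longleftrightarrow> x \<in> cbox 0 1 \<inter> {x. x \<bullet> ?e \<le> h}" for x
      unfolding Int_iff mem_Collect_eq inner_e
      using h exhaust_2[of i] by (auto simp: mem_box_cart axis_def forall_2)
    then show ?thesis by blast
  qed
  finally show ?thesis
    using integral_split[OF int e, of 0 1 h] by simp
qed

lemma periodic_int_multiple:
  fixes F :: "real ^ 2 \<Rightarrow> real"
  assumes per: "\<And>s. F (s + e) = F s"
  shows "F (s + of_int k *\<^sub>R e) = F s"
proof (induction k rule: int_induct[where k = 0])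
  case base
  then show ?case by simp
next
  case (step1 k)
  then show ?case using per[of "s + of_int k *\<^sub>R e"] by (simp add: algebra_simps)
next
  case (step2 k)
  then show ?case using per[of "s + of_int (k - 1) *\<^sub>R e"] by (simp add: algebra_simps)
qed

lemma integral_unit_box_shift_axis:
  fixes F :: "real ^ 2 \<Rightarrow> real"
  assumes F: "continuous_on UNIV F" and per: "\<And>s. F (s + axis i 1) = F s"
  shows "integral (cbox 0 1) (\<lambda>s. F (s + h *\<^sub>R axis i 1)) = integral (cbox 0 1) F"
proof -
  have "F (s + h *\<^sub>R axis i 1) = F (s + frac h *\<^sub>R axis i 1)" for s
  proof -
    have "s + h *\<^sub>R axis i 1 = (s + frac h *\<^sub>R axis i 1) + of_int \<lfloor>h\<rfloor> *\<^sub>R axis i 1"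
      by (simp add: frac_def algebra_simps)
    then show ?thesis
      using periodic_int_multiple[of F "axis i 1", OF per] by metis
  qed
  then show ?thesis
    using integral_unit_box_shift_small[OF F per, of "frac h"] by (simp add: frac_lt_1 less_imp_le)
qed

lemma integral_unit_box_shift:
  fixes F :: "real ^ 2 \<Rightarrow> real"
  assumes F: "continuous_on UNIV F" and per: "\<And>i s. F (s + axis i 1) = F s"
  shows "integral (cbox 0 1) (\<lambda>s. F (s + a)) = integral (cbox 0 1) F"
proof -
  let ?G = "\<lambda>s. F (s + (a $ 1) *\<^sub>R axis 1 1)"
  have G: "continuous_on UNIV ?G"
    by (intro continuous_shifted[OF F] continuous_intros)
  have perG: "?G (s + axis 2 1) = ?G s" for s
    using per[of "s + (a $ 1) *\<^sub>R axis 1 1" 2] by (simp add: algebra_simps)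
  have a: "a = (a $ 1) *\<^sub>R axis 1 1 + (a $ 2) *\<^sub>R axis 2 1"
    using sum_axis_components[of a] by (simp add: sum_2)
  have "F (s + a) = ?G (s + (a $ 2) *\<^sub>R axis 2 1)" for s
    by (subst a) (simp add: algebra_simps)
  then show ?thesis
    using integral_unit_box_shift_axis[OF G perG, of "a $ 2"]
      integral_unit_box_shift_axis[OF F per, of "a $ 1"] by simp
qed

text \<open>Averages over the parallelogram cell are pulled back to the unit box, so that periodicity with
  respect to the columns of \<open>P\<close> becomes periodicity along the coordinate axes.\<close>

locale lattice_cell =
  fixes P :: "real ^ 2 ^ 2" and c :: "real ^ 2"
  assumes P_invertible: "invertible P"
begin

definition average :: "field2 \<Rightarrow> real" where
  "average f = integral (cbox 0 1) (\<lambda>s. f (c + P *v s))"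

lemma continuous_cell_map: "continuous_on A (\<lambda>s. c + P *v s)"
  by (intro continuous_intros linear_continuous_on matrix_vector_mul_bounded_linear)

lemma average_integrable:
  fixes f :: field2
  shows "continuous_on UNIV f \<Longrightarrow> (\<lambda>s. f (c + P *v s)) integrable_on cbox 0 1"
  by (rule integrable_continuous, rule continuous_shifted[of f], assumption, rule continuous_cell_map)

lemma average_lincomb:
  assumes "continuous_on UNIV f" "continuous_on UNIV g"
  shows "average (\<lambda>x. a * f x + b * g x) = a * average f + b * average g"
proof -
  note i = average_integrable[OF assms(1), THEN integrable_integral]
    average_integrable[OF assms(2), THEN integrable_integral]
  show ?thesis
    unfolding average_def
    by (rule integral_unique, rule has_integral_add; rule has_integral_mult_right, rule i)
qed

lemma average_const: "average (\<lambda>_. a) = a"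
proof -
  have "measure lborel (cbox 0 (1 :: real ^ 2)) = 1"
    by (simp add: content_cbox_cart interval_ne_empty_cart)
  then show ?thesis
    by (simp add: average_def)
qed

lemma average_nonneg:
  assumes "continuous_on UNIV f" "\<And>x. 0 \<le> f x"
  shows "0 \<le> average f"
  unfolding average_def using assms by (intro integral_nonneg average_integrable) auto

text \<open>The translation invariance of the average is what replaces boundary terms everywhere below: it
  makes averages of partial derivatives vanish, and it makes averages of translates of a mean-zero field
  vanish.\<close>

lemma average_shift:
  assumes f: "continuous_on UNIV f" and per: "periodic P f"
  shows "average (\<lambda>x. f (x + y)) = average f"
proof -
  obtain Q where Q: "P ** Q = mat 1"
    using P_invertible unfolding invertible_def by blast
  let ?F = "\<lambda>s. f (c + P *v s)"
  have "integral (cbox 0 1) (\<lambda>s. ?F (s + Q *v y)) = integral (cbox 0 1) ?F"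
  proof (rule integral_unit_box_shift)
    show "continuous_on UNIV ?F"
      by (intro continuous_shifted[OF f] continuous_cell_map)
    show "?F (s + axis i 1) = ?F s" for i s
      using per[unfolded periodic_def, rule_format, of "c + P *v s" i]
      by (simp add: matrix_vector_right_distrib matrix_vector_mult_basis add.assoc)
  qed
  moreover have "?F (s + Q *v y) = f (c + P *v s + y)" for s
    using Q by (simp add: matrix_vector_right_distrib matrix_vector_mul_assoc add.assoc)
  ultimately show ?thesis
    by (simp add: average_def)
qed

text \<open>A continuous nonnegative function with integral zero over the unit box vanishes at the corner of
  the box; by translation invariance every point can be placed in the corner.\<close>

lemma average_eq_0_imp:
  assumes f: "continuous_on UNIV f" and per: "periodic P f"
    and nonneg: "\<And>x. 0 \<le> f x" and zero: "average f = 0"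
  shows "f x = 0"
proof -
  have "integral (cbox 0 1) (\<lambda>s. f (c + P *v s + (x - c))) = 0"
    using average_shift[OF f per, of "x - c"] zero by (simp add: average_def)
  moreover have "continuous_on (cbox 0 1) (\<lambda>s. f (c + P *v s + (x - c)))"
    by (intro continuous_shifted[OF f] continuous_intros continuous_cell_map)
  moreover have "box 0 (1 :: real ^ 2) \<noteq> {}"
    by (simp add: interval_ne_empty_cart)
  ultimately have "\<forall>s \<in> cbox 0 1. f (c + P *v s + (x - c)) = 0"
    using integral_cbox_eq_0_iff nonneg by blast
  then have "f (c + P *v 0 + (x - c)) = 0"
    by (rule bspec) (simp add: mem_box_cart)
  then show ?thesis by simp
qed

lemma cell_representative:
  obtains s where "s \<in> cbox 0 1" "\<And>f. periodic P f \<Longrightarrow> f x = f (c + P *v s)"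
proof -
  obtain Q where Q: "P ** Q = mat 1"
    using P_invertible unfolding invertible_def by blast
  define t where "t = Q *v (x - c)"
  define s where "s = (\<chi> i. frac (t $ i))"
  have x: "x = c + P *v t"
    using Q by (simp add: t_def matrix_vector_mul_assoc)
  have t: "t = s + of_int \<lfloor>t $ 1\<rfloor> *\<^sub>R axis 1 1 + of_int \<lfloor>t $ 2\<rfloor> *\<^sub>R axis 2 1"
    by (simp add: s_def vec_eq_iff forall_2 frac_def axis_def)
  have "f x = f (c + P *v s)" if "periodic P f" for f
  proof -
    let ?F = "\<lambda>s. f (c + P *v s)"
    have per: "?F (s + axis i 1) = ?F s" for s i
      using that[unfolded periodic_def, rule_format, of "c + P *v s" i]
      by (simp add: matrix_vector_right_distrib matrix_vector_mult_basis add.assoc)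
    have "?F t = ?F s"
      by (subst t) (simp add: periodic_int_multiple[of ?F, OF per])
    then show ?thesis
      by (simp add: x)
  qed
  moreover have "s \<in> cbox 0 1"
    by (simp add: s_def mem_box_cart frac_lt_1 less_imp_le)
  ultimately show thesis
    using that by blast
qed

lemma periodic_bounded:
  assumes f: "continuous_on UNIV f" and per: "periodic P f"
  obtains C where "\<And>x. \<bar>f x\<bar> \<le> C"
proof -
  have "compact ((\<lambda>s. f (c + P *v s)) ` cbox 0 1)"
    by (intro compact_continuous_image continuous_shifted[OF f] continuous_cell_map compact_cbox)
  then obtain C where C: "\<And>s. s \<in> cbox 0 1 \<Longrightarrow> \<bar>f (c + P *v s)\<bar> \<le> C"
    using compact_imp_bounded bounded_real by (metis imageI)
  have "\<bar>f x\<bar> \<le> C" for x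
    using C cell_representative[of x] per by metis
  then show thesis using that by blast
qed

end

section \<open>Green's identities on a period cell\<close>

lemma partial_shift:
  assumes "f differentiable (at (x + d))"
  shows "partial i (\<lambda>x. f (x + d)) x = partial i f (x + d)"
proof -
  have "((\<lambda>x. x + d) has_derivative (\<lambda>h. h)) (at x)"
    by (auto intro!: derivative_eq_intros)
  from diff_chain_at[OF this has_derivative_partial[OF assms]]
  have "((\<lambda>x. f (x + d)) has_derivative (\<lambda>h. \<Sum>i\<in>UNIV. h $ i * partial i f (x + d))) (at x)"
    by (simp add: o_def)
  then show ?thesis by (rule partialI)
qed

lemma periodic_partial:
  assumes "\<And>x. f differentiable (at x)" "periodic P f"
  shows "periodic P (partial i f)"
  unfolding periodic_def
proof (intro allI)
  fix x j
  have "(\<lambda>x. f (x + column j P)) = f"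
    using assms(2) by (simp add: periodic_def)
  then show "partial i f (x + column j P) = partial i f x"
    using partial_shift[of f x "column j P" i] assms(1) by simp
qed

lemma periodic_laplacian:
  assumes "C_class 2 f" "periodic P f"
  shows "periodic P (laplacian f)"
proof -
  have "periodic P (partial i (partial i f))" for i
    using assms by (intro periodic_partial) (auto simp: numeral_2_eq_2)
  then show ?thesis
    by (simp add: periodic_def laplacian_def)
qed

lemma periodic_lincomb: "periodic P f \<Longrightarrow> periodic P g \<Longrightarrow> periodic P (\<lambda>x. a * f x + b * g x)"
  by (simp add: periodic_def)

context lattice_cell
begin

text \<open>The average of \<open>f (x + h e)\<close> does not depend on \<open>h\<close>, and its derivative with respect to \<open>h\<close> is the
  average of the partial derivative.\<close>

lemma average_partial:
  assumes f: "C_class 1 f" and per: "periodic P f"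
  shows "average (partial i f) = 0"
proof -
  let ?e = "axis i 1 :: real ^ 2"
  have fc: "continuous_on UNIV f" and pc: "continuous_on UNIV (partial i f)"
    using C_class_1_D[OF f] by blast+
  have "((\<lambda>h. integral (cbox 0 1) (\<lambda>s. f (c + P *v s + h *\<^sub>R ?e))) has_field_derivative
      integral (cbox 0 1) (\<lambda>s. partial i f (c + P *v s + 0 *\<^sub>R ?e))) (at 0 within UNIV)"
  proof (rule leibniz_rule_field_derivative)
    show "((\<lambda>h. f (c + P *v s + h *\<^sub>R ?e)) has_field_derivative partial i f (c + P *v s + h *\<^sub>R ?e))
        (at h within UNIV)" for h s
      using f by (auto intro!: has_derivative_line)
    show "(\<lambda>s. f (c + P *v s + h *\<^sub>R ?e)) integrable_on cbox 0 1" for h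
      by (intro integrable_continuous continuous_shifted[OF fc] continuous_intros continuous_cell_map)
    show "continuous_on (UNIV \<times> cbox 0 1) (\<lambda>(h, s). partial i f (c + P *v s + h *\<^sub>R ?e))"
      unfolding split_beta
      by (intro continuous_shifted[OF pc] continuous_intros
          continuous_on_compose2[OF continuous_cell_map[of UNIV]]) auto
  qed auto
  moreover have "(\<lambda>h. integral (cbox 0 1) (\<lambda>s. f (c + P *v s + h *\<^sub>R ?e))) = (\<lambda>h. average f)"
    using average_shift[OF fc per] by (simp add: average_def)
  ultimately have "((\<lambda>h. average f) has_field_derivative average (partial i f)) (at (0::real))"
    by (simp add: average_def)
  then show ?thesis
    using DERIV_unique DERIV_const by blast
qed

lemma average_by_parts:
  assumes "C_class 1 f" "periodic P f" "C_class 1 g" "periodic P g"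
  shows "average (\<lambda>x. partial i f x * g x) = - average (\<lambda>x. f x * partial i g x)"
proof -
  have c: "continuous_on UNIV f" "continuous_on UNIV g"
      "continuous_on UNIV (partial i f)" "continuous_on UNIV (partial i g)" for i
    using C_class_1_D[OF assms(1)] C_class_1_D[OF assms(3)] by blast+
  have p: "partial i (\<lambda>x. f x * g x) = (\<lambda>x. 1 * (partial i f x * g x) + 1 * (f x * partial i g x))" for i
    using assms by (simp add: fun_eq_iff partial_mult)
  have "C_class 1 (\<lambda>x. f x * g x)"
    using assms c by (auto simp: partial_mult p intro!: continuous_intros)
  moreover have "periodic P (\<lambda>x. f x * g x)"
    using assms by (simp add: periodic_def)
  ultimately have "average (\<lambda>x. 1 * (partial i f x * g x) + 1 * (f x * partial i g x)) = 0"
    using average_partial[of "\<lambda>x. f x * g x" i] by (simp add: p)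
  also have "average (\<lambda>x. 1 * (partial i f x * g x) + 1 * (f x * partial i g x))
      = 1 * average (\<lambda>x. partial i f x * g x) + 1 * average (\<lambda>x. f x * partial i g x)"
    by (intro average_lincomb continuous_intros c)
  finally show ?thesis by simp
qed

lemma average_green:
  assumes "C_class 2 f" "periodic P f" "C_class 1 g" "periodic P g"
  shows "average (\<lambda>x. laplacian f x * g x) = - (\<Sum>i\<in>UNIV. average (\<lambda>x. partial i f x * partial i g x))"
proof -
  have p1: "C_class 1 (partial i f)" and pp: "periodic P (partial i f)" for i
    using assms by (auto simp: numeral_2_eq_2 intro!: periodic_partial)
  have c: "continuous_on UNIV g" "continuous_on UNIV (partial i (partial i f))" for i
    using C_class_1_D[OF assms(3)] C_class_1_D[OF p1[of i]] by blast+
  have "average (\<lambda>x. laplacian f x * g x) =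
      average (\<lambda>x. 1 * (partial 1 (partial 1 f) x * g x) + 1 * (partial 2 (partial 2 f) x * g x))"
    by (simp add: laplacian_def sum_2 algebra_simps)
  also have "\<dots> = 1 * average (\<lambda>x. partial 1 (partial 1 f) x * g x) + 1 * average (\<lambda>x. partial 2 (partial 2 f) x * g x)"
    by (intro average_lincomb continuous_intros c)
  also have "\<dots> = - (\<Sum>i\<in>UNIV. average (\<lambda>x. partial i f x * partial i g x))"
    using average_by_parts[OF p1 pp assms(3,4)] by (simp add: sum_2)
  finally show ?thesis .
qed

lemma average_laplacian_symmetric:
  assumes "C_class 2 f" "periodic P f" "C_class 2 g" "periodic P g"
  shows "average (\<lambda>x. laplacian f x * g x) = average (\<lambda>x. f x * laplacian g x)"
proof -
  have "C_class 1 f" "C_class 1 g"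
    using assms C_class_mono[of 1 2] by auto
  with average_green[of f g] average_green[of g f] assms show ?thesis
    by (simp add: mult.commute)
qed

lemma average_laplacian:
  assumes "C_class 2 f" "periodic P f"
  shows "average (laplacian f) = 0"
  using average_laplacian_symmetric[OF assms C_class_const[of 2 1]] 
  by (simp add: laplacian_const[abs_def] periodic_def average_const)

lemma average_laplacian_nonpos:
  assumes "C_class 2 f" "periodic P f"
  shows "average (\<lambda>x. laplacian f x * f x) \<le> 0"
proof -
  have f1: "C_class 1 f"
    using assms C_class_mono[of 1 2] by auto
  then have "continuous_on UNIV (partial i f)" for i
    by auto
  then have "0 \<le> average (\<lambda>x. partial i f x * partial i f x)" for i
    by (intro average_nonneg continuous_intros) auto
  then show ?thesis
    using average_green[OF assms f1 assms(2)] by (simp add: sum_nonneg)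
qed

text \<open>Green's identity for \<open>f\<close> with itself shows that the gradient has mean square zero.\<close>

lemma harmonic_imp_constant:
  assumes f: "C_class 2 f" "periodic P f" and harm: "\<And>x. laplacian f x = 0"
  shows "f x = average f"
proof -
  have f1: "C_class 1 f"
    using f C_class_mono[of 1 2] by auto
  have pc: "continuous_on UNIV (partial i f)" for i
    using f1 by auto
  have nn: "0 \<le> average (\<lambda>x. partial i f x * partial i f x)" for i
    by (intro average_nonneg continuous_intros pc) auto
  have "(\<Sum>i\<in>UNIV. average (\<lambda>x. partial i f x * partial i f x)) = 0"
    using average_green[OF f f1 f(2)] by (simp add: harm average_const)
  then have "average (\<lambda>x. partial i f x * partial i f x) = 0" for i
    using nn by (simp add: sum_nonneg_eq_0_iff)
  moreover have "periodic P (\<lambda>x. partial i f x * partial i f x)" for i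
    using periodic_partial[of f P i] f1 f(2) by (simp add: periodic_def)
  ultimately have "partial i f x * partial i f x = 0" for i x
    using average_eq_0_imp[of "\<lambda>x. partial i f x * partial i f x" x] pc by (simp add: continuous_intros)
  then have "partial i f x = 0" for i x by simp
  then have "(f has_derivative (\<lambda>h. 0)) (at x within UNIV)" for x
    using has_derivative_partial[of f x] f1 by simp
  then obtain k where "\<And>x. f x = k"
    using has_derivative_zero_constant[of UNIV f] by auto
  then have "f = (\<lambda>_. k)" by blast
  then show ?thesis by (simp add: average_const)
qed

end

section \<open>Averages over discs and their potentials\<close>

lemma has_field_derivative_max_square:
  "((\<lambda>r. (max 0 r)\<^sup>2) has_field_derivative 2 * max 0 r) (at (r::real))"
proof -
  have "(max 0 y)\<^sup>2 - (max 0 r)\<^sup>2 = (max 0 y + max 0 r) * (max 0 y - max 0 r)" for y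
    by (simp add: power2_eq_square algebra_simps)
  consider "r > 0" | "r < 0" | "r = 0" by linarith
  then show ?thesis
  proof cases
    case 1
    have "((\<lambda>r. r\<^sup>2) has_field_derivative 2 * max 0 r) (at r)"
      using 1 by (auto intro!: derivative_eq_intros)
    then show ?thesis
      by (rule has_field_derivative_transform_within_open[where S = "{0<..}"]) (use 1 in auto)
  next
    case 2
    have "((\<lambda>r. 0) has_field_derivative 2 * max 0 r) (at r)"
      using 2 by simp
    then show ?thesis
      by (rule has_field_derivative_transform_within_open[where S = "{..<0}"]) (use 2 in auto)
  next
    case 3
    \<comment> \<open>At the kink, Caratheodory's criterion applies: \<open>(max 0 y)\<^sup>2 = max 0 y * y\<close>.\<close>
    have "isCont (\<lambda>y. max 0 y) (0::real)"
      by (intro continuous_intros)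
    then show ?thesis
      unfolding CARAT_DERIV
      by (intro exI[of _ "\<lambda>y. max 0 y"]) (auto simp: 3 power2_eq_square max_def)
  qed
qed

text \<open>Two radial kernels supported in the disc of radius \<open>R\<close> and tied together by
  \<open>grad bump = - bump_slope * z\<close>. This relation makes the average of a field with weight \<open>bump_slope\<close>
  over a disc change, as the disc grows, at a rate given by the average of the Laplacian with weight
  \<open>bump\<close>.\<close>

definition bump :: "real \<Rightarrow> field2" where
  "bump R z = (max 0 (R\<^sup>2 - z \<bullet> z))\<^sup>2"

definition bump_slope :: "real \<Rightarrow> field2" where
  "bump_slope R z = 4 * max 0 (R\<^sup>2 - z \<bullet> z)"

lemma partial_bump:
  shows "bump R differentiable (at z)" and "partial i (bump R) z = - (bump_slope R z * z $ i)"
proof -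
  have "((\<lambda>z. R\<^sup>2 - z \<bullet> z) has_derivative (\<lambda>h. - (2 * (z \<bullet> h)))) (at z)"
    by (auto intro!: derivative_eq_intros simp: fun_eq_iff inner_commute)
  from diff_chain_at[OF this has_field_derivative_max_square[unfolded has_field_derivative_def]]
  have "(bump R has_derivative (\<lambda>h. 2 * max 0 (R\<^sup>2 - z \<bullet> z) * - (2 * (z \<bullet> h)))) (at z)"
    by (simp add: o_def bump_def[abs_def])
  moreover have "2 * max 0 (R\<^sup>2 - z \<bullet> z) * - (2 * (z \<bullet> h)) = (\<Sum>i\<in>UNIV. h $ i * - (bump_slope R z * z $ i))" for h
  proof -
    have "2 * m * - (2 * (z \<bullet> h)) = (\<Sum>i\<in>UNIV. h $ i * - (4 * m * z $ i))" for m
      by (simp add: inner_vec_def sum_distrib_left sum_negf ac_simps)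
    then show ?thesis
      by (simp add: bump_slope_def)
  qed
  ultimately have "(bump R has_derivative (\<lambda>h. \<Sum>i\<in>UNIV. h $ i * - (bump_slope R z * z $ i))) (at z)"
    by simp
  from partialI[OF this] show "bump R differentiable (at z)" "partial i (bump R) z = - (bump_slope R z * z $ i)"
    by blast+
qed

lemma continuous_bump_slope: "continuous_on A (bump_slope R)"
  unfolding bump_slope_def[abs_def] by (intro continuous_intros)

lemma C_class_bump: "C_class 1 (bump R)"
proof -
  have "partial i (bump R) = (\<lambda>z. - (bump_slope R z * z $ i))" for i
    by (simp add: fun_eq_iff partial_bump)
  then show ?thesis
    by (auto simp: partial_bump intro!: continuous_intros continuous_bump_slope)
qed

lemma bump_nonneg: "0 \<le> bump R z" "0 \<le> bump_slope R z"
  by (simp_all add: bump_def bump_slope_def)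

lemma bump_eq_0:
  assumes "0 \<le> R" "R \<le> \<bar>z $ i\<bar>"
  shows "bump R z = 0"
proof -
  have "R\<^sup>2 \<le> \<bar>z $ i\<bar>\<^sup>2"
    using assms by (intro power_mono) auto
  also have "\<dots> \<le> (norm z)\<^sup>2"
    by (intro power_mono component_le_norm_cart) auto
  finally show ?thesis
    by (simp add: bump_def power2_norm_eq_inner)
qed

definition square_box :: "real \<Rightarrow> (real ^ 2) set" where
  "square_box R = cbox (vec (- R)) (vec R)"

lemma mem_square_box: "z \<in> square_box R \<longleftrightarrow> (\<forall>i. \<bar>z $ i\<bar> \<le> R)"
  by (auto simp: square_box_def mem_box_cart abs_le_iff minus_le_iff)

text \<open>The box is wider than the support by one on every side, so that the integral of a translate of \<open>F\<close>
  stays constant for translations shorter than one; its derivative at the origin is the integral of the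
  partial derivative.\<close>

lemma integral_partial_eq_0:
  assumes F: "C_class 1 F" and supp: "\<And>z i. R \<le> \<bar>z $ i\<bar> \<Longrightarrow> F z = 0"
  shows "integral (square_box (R + 1)) (partial i F) = 0"
proof -
  let ?e = "axis i 1 :: real ^ 2"
  note Fc = C_class_1_D(2)[OF F] and pc = C_class_1_D(3)[OF F]
  define I where "I = integral (square_box R) F"
  have I: "(F has_integral I) (square_box R)"
    unfolding I_def square_box_def
    by (intro integrable_integral integrable_continuous continuous_on_subset[OF Fc]) auto
  define g where "g h = integral (square_box (R + 1)) (\<lambda>z. F (z + h *\<^sub>R ?e))" for h
  have g: "g h = I" if "\<bar>h\<bar> < 1" for h
  proof -
    have "g h = integral (cbox (vec (- (R + 1)) + h *\<^sub>R ?e) (vec (R + 1) + h *\<^sub>R ?e)) F"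
      using integral_shift_cbox[of "vec (- (R + 1)) + h *\<^sub>R ?e" "h *\<^sub>R ?e" "vec (R + 1) + h *\<^sub>R ?e" F]
      by (simp add: g_def square_box_def)
    also have "\<dots> = I"
    proof (rule integral_unique, rule has_integral_on_superset[OF I])
      show "F x = 0" if "x \<notin> square_box R" for x
        using that supp unfolding mem_square_box by (meson le_cases)
      show "square_box R \<subseteq> cbox (vec (- (R + 1)) + h *\<^sub>R ?e) (vec (R + 1) + h *\<^sub>R ?e)"
      proof
        fix x assume x: "x \<in> square_box R"
        have "\<bar>x $ j\<bar> \<le> R \<and> \<bar>(h *\<^sub>R ?e) $ j\<bar> < 1" for j
          using x that by (auto simp: mem_square_box axis_def)
        then show "x \<in> cbox (vec (- (R + 1)) + h *\<^sub>R ?e) (vec (R + 1) + h *\<^sub>R ?e)"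
          unfolding mem_box_cart vector_add_component vec_component
          by (smt (verit))
      qed
    qed
    finally show ?thesis .
  qed
  have "(g has_field_derivative integral (square_box (R + 1)) (\<lambda>z. partial i F (z + 0 *\<^sub>R ?e))) (at 0 within UNIV)"
    unfolding g_def[abs_def] square_box_def
  proof (rule leibniz_rule_field_derivative)
    show "((\<lambda>h. F (z + h *\<^sub>R ?e)) has_field_derivative partial i F (z + h *\<^sub>R ?e)) (at h within UNIV)" for h z
      using C_class_1_D(1)[OF F] by (auto intro!: has_derivative_line)
    show "(\<lambda>z. F (z + h *\<^sub>R ?e)) integrable_on cbox (vec (- (R + 1))) (vec (R + 1))" for h
      by (intro integrable_continuous continuous_shifted[OF Fc] continuous_intros)
    show "continuous_on (UNIV \<times> cbox (vec (- (R + 1))) (vec (R + 1))) (\<lambda>(h, z). partial i F (z + h *\<^sub>R ?e))"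
      unfolding split_beta by (intro continuous_shifted[OF pc] continuous_intros)
  qed auto
  then have "((\<lambda>h. I) has_field_derivative integral (square_box (R + 1)) (\<lambda>z. partial i F (z + 0 *\<^sub>R ?e))) (at 0)"
    by (rule has_field_derivative_transform_within_open[where S = "{-1<..<1}"]) (auto simp: g)
  from DERIV_unique[OF this DERIV_const] show ?thesis
    by simp
qed

lemma partial_affine:
  assumes "f differentiable (at (x + t *\<^sub>R z))"
  shows "(\<lambda>z. f (x + t *\<^sub>R z)) differentiable (at z)"
    and "partial i (\<lambda>z. f (x + t *\<^sub>R z)) z = t * partial i f (x + t *\<^sub>R z)"
proof -
  have "((\<lambda>z. x + t *\<^sub>R z) has_derivative (\<lambda>h. t *\<^sub>R h)) (at z)"
    by (auto intro!: derivative_eq_intros)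
  from diff_chain_at[OF this has_derivative_partial[OF assms]]
  have "((\<lambda>z. f (x + t *\<^sub>R z)) has_derivative
      (\<lambda>h. \<Sum>i\<in>UNIV. h $ i * (t * partial i f (x + t *\<^sub>R z)))) (at z)"
    by (simp add: o_def ac_simps)
  from partialI[OF this] show "(\<lambda>z. f (x + t *\<^sub>R z)) differentiable (at z)"
      "partial i (\<lambda>z. f (x + t *\<^sub>R z)) z = t * partial i f (x + t *\<^sub>R z)"
    by blast+
qed

lemma bump_by_parts:
  assumes f: "C_class 1 f" and R: "0 \<le> R"
  shows "integral (square_box (R + 1)) (\<lambda>z. bump_slope R z * (z $ i * f (x + t *\<^sub>R z))) =
    integral (square_box (R + 1)) (\<lambda>z. t * (bump R z * partial i f (x + t *\<^sub>R z)))"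
proof -
  note fd = C_class_1_D(1)[OF f] and fc = C_class_1_D(2)[OF f] and pc = C_class_1_D(3)[OF f]
  note bc = C_class_1_D(2)[OF C_class_bump, of R] and sc = continuous_bump_slope[of UNIV R]
  let ?F = "\<lambda>z. bump R z * f (x + t *\<^sub>R z)"
  have p: "partial i ?F = (\<lambda>z. t * (bump R z * partial i f (x + t *\<^sub>R z)) - bump_slope R z * (z $ i * f (x + t *\<^sub>R z)))" for i
    by (simp add: fun_eq_iff partial_mult partial_bump partial_affine fd)
  have "C_class 1 ?F"
    unfolding One_nat_def C_class.simps p
    by (auto simp: partial_mult partial_bump partial_affine fd
      intro!: continuous_intros continuous_shifted[OF pc] continuous_shifted[OF fc] sc bc)
  moreover have "?F z = 0" if "R \<le> \<bar>z $ i\<bar>" for z i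
    using bump_eq_0[OF R that] by simp
  ultimately have "integral (square_box (R + 1)) (partial i ?F) = 0"
    by (rule integral_partial_eq_0)
  moreover have "integral (square_box (R + 1)) (partial i ?F) =
      integral (square_box (R + 1)) (\<lambda>z. t * (bump R z * partial i f (x + t *\<^sub>R z)))
      - integral (square_box (R + 1)) (\<lambda>z. bump_slope R z * (z $ i * f (x + t *\<^sub>R z)))"
    unfolding p square_box_def
    by (intro integral_diff integrable_continuous continuous_intros continuous_bump_slope
        continuous_shifted[OF pc] continuous_shifted[OF fc] continuous_shifted[OF bc])
  ultimately show ?thesis
    by simp
qed

text \<open>\<open>ball_average\<close> is the average over the disc of radius \<open>R\<close> with normalised weight \<open>bump_slope\<close>.
  \<open>ball_potential\<close> is chosen so that its Laplacian is \<open>ball_average\<close> minus the identity; it integrates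
  over the pairs of a scale \<open>t\<close> in the unit interval and a displacement \<open>z\<close>.\<close>

definition bump_mass :: "real \<Rightarrow> real" where
  "bump_mass R = integral (square_box (R + 1)) (bump_slope R)"

definition ball_average :: "real \<Rightarrow> field2 \<Rightarrow> field2" where
  "ball_average R = smear (vec (- (R + 1))) (vec (R + 1)) (\<lambda>z. bump_slope R z / bump_mass R) (\<lambda>z. z)"

definition ball_potential :: "real \<Rightarrow> field2 \<Rightarrow> field2" where
  "ball_potential R = smear (0, vec (- (R + 1))) (1, vec (R + 1))
     (\<lambda>p. fst p * bump R (snd p) / bump_mass R) (\<lambda>p. fst p *\<^sub>R snd p)"

lemma bump_mass_pos:
  assumes "R > 0"
  shows "bump_mass R > 0"
proof -
  have "integral (square_box (R + 1)) (bump_slope R) \<ge> 0"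
    unfolding square_box_def
    by (intro integral_nonneg integrable_continuous continuous_bump_slope bump_nonneg)
  moreover have "integral (square_box (R + 1)) (bump_slope R) \<noteq> 0"
  proof
    assume "integral (square_box (R + 1)) (bump_slope R) = 0"
    moreover have "box (vec (- (R + 1))) (vec (R + 1) :: real ^ 2) \<noteq> {}"
      using assms by (simp add: interval_ne_empty_cart)
    ultimately have "\<forall>z \<in> square_box (R + 1). bump_slope R z = 0"
      unfolding square_box_def
      using integral_cbox_eq_0_iff continuous_bump_slope bump_nonneg(2) by blast
    moreover have "0 \<in> square_box (R + 1)"
      using assms by (simp add: mem_square_box)
    ultimately have "bump_slope R 0 = 0"
      by blast
    then show False
      using assms by (simp add: bump_slope_def)
  qed
  ultimately show ?thesis
    by (simp add: bump_mass_def)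
qed

lemma ball_kernels_continuous:
  "continuous_on A (\<lambda>z. bump_slope R z / bump_mass R)"
  "continuous_on B (\<lambda>p :: real \<times> (real ^ 2). fst p * bump R (snd p) / bump_mass R)"
  "continuous_on B (\<lambda>p :: real \<times> (real ^ 2). fst p *\<^sub>R snd p)"
proof -
  have "continuous_on B (\<lambda>p :: real \<times> (real ^ 2). bump R (snd p))"
    by (intro continuous_shifted[OF C_class_1_D(2)[OF C_class_bump]] continuous_intros)
  then show "continuous_on B (\<lambda>p :: real \<times> (real ^ 2). fst p * bump R (snd p) / bump_mass R)"
    by (cases "bump_mass R = 0") (auto intro!: continuous_intros)
  show "continuous_on A (\<lambda>z. bump_slope R z / bump_mass R)"
    by (cases "bump_mass R = 0") (auto intro!: continuous_intros continuous_bump_slope)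
qed (intro continuous_intros)

lemma laplacian_smear:
  assumes W: "continuous_on (cbox a b) W" and s: "continuous_on (cbox a b) \<sigma>"
    and f: "C_class 2 f"
  shows "laplacian (smear a b W \<sigma> f) x = smear a b W \<sigma> (laplacian f) x"
proof -
  have f1: "C_class 1 f" and pf: "C_class 1 (partial i f)" for i
    using f C_class_mono[of 1 2] by (auto simp: numeral_2_eq_2)
  note pc = C_class_1_D(3)[OF pf]
  have p: "partial i (smear a b W \<sigma> f) = smear a b W \<sigma> (partial i f)" for i
    using partial_smear(2)[OF W s f1] by blast
  have "laplacian (smear a b W \<sigma> f) x = (\<Sum>i\<in>UNIV. smear a b W \<sigma> (partial i (partial i f)) x)"
    by (simp add: laplacian_def p partial_smear(2)[OF W s pf])
  also have "\<dots> = integral (cbox a b) (\<lambda>p. \<Sum>i\<in>UNIV. W p * partial i (partial i f) (x + \<sigma> p))"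
    unfolding smear_def
    by (intro integral_sum[symmetric] integrable_continuous continuous_intros W continuous_shifted[OF pc] s) auto
  finally show ?thesis
    by (simp add: smear_def laplacian_def sum_distrib_left)
qed

text \<open>Let \<open>D t\<close> be the disc average of \<open>f\<close> at scale \<open>t\<close>, which interpolates between \<open>f x\<close> at \<open>t = 0\<close> and
  \<open>ball_average R f x\<close> at \<open>t = 1\<close>. Its derivative contains \<open>bump_slope\<close> times \<open>z\<close>, which is a gradient,
  and an integration by parts turns it into \<open>t\<close> times the average of the Laplacian with weight \<open>bump\<close>.
  Integration over \<open>t\<close> gives the claim.\<close>

lemma laplacian_ball_potential:
  assumes f: "C_class 2 f" and R: "R > 0"
  shows "laplacian (ball_potential R f) x = ball_average R f x - f x"
proof -
  let ?K = "square_box (R + 1)" and ?Z = "bump_mass R"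
  have Z: "?Z > 0" using bump_mass_pos[OF R] .
  have f1: "C_class 1 f" and pf: "C_class 1 (partial i f)" for i
    using f C_class_mono[of 1 2] by (auto simp: numeral_2_eq_2)
  note fc = C_class_1_D(2)[OF f1] and pc = C_class_1_D(3)[OF f1] and ppc = C_class_1_D(3)[OF pf]
  note bc = C_class_1_D(2)[OF C_class_bump, of R] and sc = continuous_bump_slope[of UNIV R]
  have lc: "continuous_on UNIV (laplacian f)"
    using C_class_laplacian[of 0 f] f by (simp add: numeral_2_eq_2)
  define D where "D t = integral ?K (\<lambda>z. bump_slope R z / ?Z * f (x + t *\<^sub>R z))" for t
  define D' where "D' t = integral ?K (\<lambda>z. t * bump R z / ?Z * laplacian f (x + t *\<^sub>R z))" for t
  have D: "(D has_field_derivative D' t) (at t)" for t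
  proof -
    let ?d = "\<lambda>t z. \<Sum>i\<in>UNIV. (bump_slope R z * (z $ i * partial i f (x + t *\<^sub>R z))) / ?Z"
    have "(D has_field_derivative integral ?K (?d t)) (at t within UNIV)"
      unfolding D_def[abs_def] square_box_def
    proof (rule leibniz_rule_field_derivative)
      show "((\<lambda>t. bump_slope R z / ?Z * f (x + t *\<^sub>R z)) has_field_derivative ?d t z) (at t within UNIV)" for t z
      proof -
        have "((\<lambda>t. x + t *\<^sub>R z) has_derivative (\<lambda>h. h *\<^sub>R z)) (at t)"
          by (auto intro!: derivative_eq_intros)
        from has_derivative_mult_right[OF diff_chain_at[OF this has_derivative_partial[OF C_class_1_D(1)[OF f1]]], of "bump_slope R z / ?Z"]
        show ?thesis
          unfolding has_field_derivative_def o_def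
          by (rule has_derivative_eq_rhs) (simp add: fun_eq_iff sum_distrib_left sum_distrib_right ac_simps)
      qed
      show "(\<lambda>z. bump_slope R z / ?Z * f (x + t *\<^sub>R z)) integrable_on cbox (vec (- (R + 1))) (vec (R + 1))" for t
        using Z by (intro integrable_continuous continuous_intros continuous_shifted[OF fc] continuous_bump_slope) auto
      show "continuous_on (UNIV \<times> cbox (vec (- (R + 1))) (vec (R + 1))) (\<lambda>(t, z). ?d t z)"
        using Z unfolding split_beta
        by (intro continuous_intros continuous_shifted[OF pc] continuous_shifted[OF sc]) auto
    qed auto
    also have "integral ?K (?d t) = (\<Sum>i\<in>UNIV. integral ?K (\<lambda>z. bump_slope R z * (z $ i * partial i f (x + t *\<^sub>R z))) / ?Z)"
      unfolding square_box_def using Z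
      by (subst integral_sum)
         (auto intro!: integrable_continuous continuous_intros continuous_shifted[OF pc] continuous_bump_slope)
    also have "\<dots> = (\<Sum>i\<in>UNIV. integral ?K (\<lambda>z. t * (bump R z * partial i (partial i f) (x + t *\<^sub>R z))) / ?Z)"
      using R by (simp add: bump_by_parts[OF pf])
    also have "\<dots> = integral ?K (\<lambda>z. \<Sum>i\<in>UNIV. t * (bump R z * partial i (partial i f) (x + t *\<^sub>R z)) / ?Z)"
      unfolding square_box_def using Z
      by (subst integral_sum)
         (auto intro!: integrable_continuous continuous_intros continuous_shifted[OF ppc] continuous_shifted[OF bc])
    also have "\<dots> = D' t"
      by (simp add: D'_def laplacian_def sum_distrib_left algebra_simps)
    finally show ?thesis by simp
  qed
  have "laplacian (ball_potential R f) x =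
      integral (cbox (0, vec (- (R + 1))) (1, vec (R + 1)))
       (\<lambda>p. fst p * bump R (snd p) / ?Z * laplacian f (x + fst p *\<^sub>R snd p))"
    unfolding ball_potential_def
    by (subst laplacian_smear[OF ball_kernels_continuous(2,3) f]) (simp add: smear_def)
  also have "\<dots> = integral (cbox 0 1) D'"
  proof -
    have "continuous_on (cbox (0, vec (- (R + 1))) (1, vec (R + 1)))
        (\<lambda>p. fst p * bump R (snd p) / ?Z * laplacian f (x + fst p *\<^sub>R snd p))"
      by (rule continuous_on_mult[OF ball_kernels_continuous(2)],
          intro continuous_shifted[OF lc] continuous_intros)
    from integral_prod_continuous[OF this] show ?thesis
      unfolding D'_def[abs_def] square_box_def fst_conv snd_conv .
  qed
  also have "\<dots> = D 1 - D 0"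
  proof -
    have "(D' has_integral (D 1 - D 0)) {0..1}"
      by (rule fundamental_theorem_of_calculus)
         (auto simp: has_real_derivative_iff_has_vector_derivative[symmetric] intro: has_field_derivative_at_within D)
    then show ?thesis by (simp add: integral_unique)
  qed
  also have "D 1 = ball_average R f x"
    by (simp add: D_def ball_average_def smear_def square_box_def)
  also have "D 0 = f x"
  proof -
    have "D 0 = integral ?K (bump_slope R) / ?Z * f x"
      by (simp add: D_def mult.commute)
    then show ?thesis using Z by (simp add: bump_mass_def)
  qed
  finally show ?thesis .
qed

section \<open>Solvability of the Poisson equation\<close>

lemma smear_bound:
  assumes W: "continuous_on (cbox a b) W" and s: "continuous_on (cbox a b) \<sigma>"
    and W0: "\<And>p. p \<in> cbox a b \<Longrightarrow> 0 \<le> W p"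
    and f: "continuous_on UNIV f" and C: "\<And>x. \<bar>f x\<bar> \<le> C"
  shows "\<bar>smear a b W \<sigma> f x\<bar> \<le> integral (cbox a b) W * C"
proof -
  have "norm (integral (cbox a b) (\<lambda>p. W p * f (x + \<sigma> p))) \<le> integral (cbox a b) (\<lambda>p. W p * C)"
  proof (rule integral_norm_bound_integral)
    show "(\<lambda>p. W p * f (x + \<sigma> p)) integrable_on cbox a b" "(\<lambda>p. W p * C) integrable_on cbox a b"
      by (intro integrable_continuous continuous_intros W s continuous_shifted[OF f])+
    show "norm (W p * f (x + \<sigma> p)) \<le> W p * C" if "p \<in> cbox a b" for p
      using W0[OF that] C by (simp add: abs_mult mult_left_mono)
  qed
  then show ?thesis
    by (simp add: smear_def)
qed

lemma periodic_smear: "periodic P f \<Longrightarrow> periodic P (smear a b W \<sigma> f)"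
proof -
  assume "periodic P f"
  then have "f (x + column i P + y) = f (x + y)" for x y i
    using add.commute add.assoc unfolding periodic_def by metis
  then show ?thesis
    by (simp add: periodic_def smear_def)
qed

context lattice_cell
begin

definition cell :: "(real ^ 2) set" where
  "cell = (\<lambda>s. c + P *v s) ` cbox 0 1"

lemma integral_cell:
  assumes f: "continuous_on UNIV f"
  shows "f integrable_on cell" and "integral cell f = \<bar>det P\<bar> * average f"
proof -
  let ?g = "\<lambda>s. c + P *v s" and ?f = "\<lambda>x. vec (f x) :: real ^ 1"
  let ?b = "integral (cbox 0 1) (\<lambda>s. \<bar>det P\<bar> *\<^sub>R ?f (?g s))"
  \<comment> \<open>The change of variables theorem is about vector-valued functions, hence the detour through
    one-dimensional vectors.\<close>
  have fc: "continuous_on A ?f" for A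
    unfolding vec_def by (intro continuous_on_vec_lambda continuous_on_subset[OF f]) auto
  have inj: "inj_on ?g (cbox 0 1)"
    using inj_matrix_vector_mult[OF P_invertible] by (auto simp: inj_on_def)
  have der: "(?g has_derivative (*v) P) (at s within cbox 0 1)" for s
    using has_derivative_add[OF has_derivative_const[of c]
        bounded_linear_imp_has_derivative[OF matrix_vector_mul_bounded_linear[of P]]] by simp
  have "(\<lambda>s. \<bar>det (matrix ((*v) P))\<bar> *\<^sub>R ?f (?g s)) absolutely_integrable_on cbox 0 1"
    by (intro absolutely_integrable_continuous continuous_intros
       continuous_on_compose2[OF fc[of UNIV] continuous_cell_map]) auto
  with has_absolute_integral_change_of_variables_compact[OF compact_cbox der inj, of ?f ?b]
  have "?f absolutely_integrable_on cell \<and> integral cell ?f = ?b"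
    by (simp add: cell_def)
  then have i: "?f integrable_on cell" and e: "integral cell ?f = ?b"
    by (auto simp: absolutely_integrable_on_def)
  have bl: "bounded_linear (\<lambda>v :: real ^ 1. v $ 1)"
    by (rule bounded_linear_vec_nth)
  show "f integrable_on cell"
    using integrable_linear[OF i bl] by (simp add: o_def)
  have "integral cell f = ?b $ 1"
    using integral_linear[OF i bl] e by (simp add: o_def)
  also have "\<dots> = integral (cbox 0 1) (\<lambda>s. \<bar>det P\<bar> * f (?g s))"
  proof -
    have "(\<lambda>s. \<bar>det P\<bar> *\<^sub>R ?f (?g s)) integrable_on cbox 0 1"
      by (intro integrable_continuous continuous_intros
        continuous_on_compose2[OF fc[of UNIV] continuous_cell_map]) auto
    from integral_linear[OF this bl, symmetric] show ?thesis
      by (simp add: o_def del: integral_mult_right integral_cmul)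
  qed
  finally show "integral cell f = \<bar>det P\<bar> * average f"
    by (simp add: average_def)
qed

lemma det_nonzero: "det P \<noteq> 0"
  using P_invertible invertible_det_nz by blast

lemma average_smear:
  assumes W: "continuous_on (cbox a b) W" and s: "continuous_on (cbox a b) \<sigma>"
    and f: "continuous_on UNIV f" and per: "periodic P f"
  shows "average (smear a b W \<sigma> f) = integral (cbox a b) W * average f"
proof -
  have "average (smear a b W \<sigma> f) =
      integral (cbox a b) (\<lambda>p. integral (cbox 0 1) (\<lambda>s. W p * f (c + P *v s + \<sigma> p)))"
    unfolding average_def smear_def
    by (rule integral_swap_continuous)
       (auto simp: split_beta cbox_Pair_eq intro!: continuous_intros continuous_shifted[OF f]
        continuous_on_compose2[OF W] continuous_on_compose2[OF s]
        continuous_on_compose2[OF continuous_cell_map[of UNIV]])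
  also have "\<dots> = integral (cbox a b) (\<lambda>p. W p * average (\<lambda>x. f (x + \<sigma> p)))"
    by (simp add: average_def)
  finally show ?thesis
    by (simp add: average_shift[OF f per])
qed

text \<open>Doeblin's argument. For large \<open>R\<close> the weight is at least some \<open>\<delta> > 0\<close> on the whole cell, and
  removing \<open>\<delta>\<close> times the indicator of the cell from the weight does not change the average of a
  mean-zero periodic field, because the integral of a translate of the field over the cell vanishes.
  The remaining weight \<open>G\<close> is nonnegative and has mass \<open>\<theta> = 1 - \<delta> * \<bar>det P\<bar>\<close>.\<close>

lemma ball_average_contraction:
  obtains R \<theta> where "R > 0" "0 \<le> \<theta>" "\<theta> < 1"
    "\<And>f C x. \<lbrakk>continuous_on UNIV f; periodic P f; average f = 0; \<And>y. \<bar>f y\<bar> \<le> C\<rbrakk>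
      \<Longrightarrow> \<bar>ball_average R f x\<bar> \<le> \<theta> * C"
proof -
  have "compact cell"
    unfolding cell_def by (intro compact_continuous_image continuous_cell_map compact_cbox)
  then obtain r where r: "\<And>z. z \<in> cell \<Longrightarrow> norm z \<le> r"
    using compact_imp_bounded bounded_iff by metis
  define R where "R = 2 * max 1 r"
  have R: "R > 0" by (simp add: R_def)
  have Rz: "norm z \<le> R / 2" if "z \<in> cell" for z
    using r[OF that] by (simp add: R_def)
  let ?K = "square_box (R + 1)" and ?Z = "bump_mass R"
  have Z: "?Z > 0" using bump_mass_pos[OF R] .
  have sub: "cell \<subseteq> ?K"
  proof
    fix z assume "z \<in> cell"
    then have "\<bar>z $ i\<bar> \<le> R + 1" for i
      using Rz[of z] component_le_norm_cart[of z i] R by linarith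
    then show "z \<in> ?K"
      by (simp add: mem_square_box)
  qed
  \<comment> \<open>On the cell the norm is at most half of \<open>R\<close>, so \<open>bump_slope R\<close> is at least
    \<open>4 * (R\<^sup>2 - R\<^sup>2 / 4) = 3 * R\<^sup>2\<close> there.\<close>
  define \<delta> where "\<delta> = 3 * R\<^sup>2 / ?Z"
  have \<delta>: "\<delta> > 0" using R Z by (simp add: \<delta>_def)
  define G where "G z = bump_slope R z / ?Z - (if z \<in> cell then \<delta> else 0)" for z
  have G0: "0 \<le> G z" for z
  proof (cases "z \<in> cell")
    case True
    have "(norm z)\<^sup>2 \<le> (R / 2)\<^sup>2"
      using Rz[OF True] by (intro power_mono) auto
    moreover have "4 * (R\<^sup>2 - z \<bullet> z) \<le> bump_slope R z"
      unfolding bump_slope_def by (intro mult_left_mono max.cobounded2) auto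
    ultimately have "3 * R\<^sup>2 \<le> bump_slope R z"
      by (simp add: power2_norm_eq_inner power_divide)
    then show ?thesis
      using Z True by (simp add: G_def \<delta>_def divide_right_mono)
  next
    case False
    then show ?thesis
      using Z bump_nonneg[of R z] by (simp add: G_def)
  qed
  have Gf: "(\<lambda>z. G z * f (x + z)) integrable_on ?K"
    and Gf_eq: "integral ?K (\<lambda>z. G z * f (x + z)) = ball_average R f x - \<delta> * integral cell (\<lambda>z. f (x + z))"
    if f: "continuous_on UNIV f" for f x
  proof -
    have fx: "continuous_on A (\<lambda>z. f (x + z))" for A
      by (intro continuous_shifted[OF f] continuous_intros)
    have eq: "G z * f (x + z) = bump_slope R z / ?Z * f (x + z) - \<delta> * (if z \<in> cell then f (x + z) else 0)" for z
      by (simp add: G_def algebra_simps)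
    have int1: "((\<lambda>z. bump_slope R z / ?Z * f (x + z)) has_integral ball_average R f x) ?K"
      unfolding ball_average_def smear_def square_box_def
      by (intro integrable_integral integrable_continuous continuous_on_mult
          ball_kernels_continuous(1) fx)
    have "cell \<inter> ?K = cell" using sub by blast
    then have int2: "((\<lambda>z. \<delta> * (if z \<in> cell then f (x + z) else 0)) has_integral
        \<delta> * integral cell (\<lambda>z. f (x + z))) ?K"
      using integral_cell(1)[OF fx]
      by (intro has_integral_mult_right) (simp add: has_integral_restrict_Int integrable_integral)
    note has_integral_diff[OF int1 int2, folded eq]
    then show "(\<lambda>z. G z * f (x + z)) integrable_on ?K"
      "integral ?K (\<lambda>z. G z * f (x + z)) = ball_average R f x - \<delta> * integral cell (\<lambda>z. f (x + z))"
      by (auto intro: integral_unique)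
  qed
  define \<theta> where "\<theta> = 1 - \<delta> * \<bar>det P\<bar>"
  have G1: "G integrable_on ?K" and G1_eq: "integral ?K G = \<theta>"
  proof -
    have "ball_average R (\<lambda>_. 1) 0 = 1"
      using Z by (simp add: ball_average_def smear_def bump_mass_def square_box_def)
    then show "G integrable_on ?K" "integral ?K G = \<theta>"
      using Gf[of "\<lambda>_. 1" 0] Gf_eq[of "\<lambda>_. 1" 0] integral_cell(2)[of "\<lambda>_. 1"] average_const[of 1]
      by (simp_all add: \<theta>_def)
  qed
  have "\<theta> \<ge> 0"
    using integral_nonneg[OF G1 G0] G1_eq by simp
  moreover have "\<theta> < 1"
    using \<delta> det_nonzero by (simp add: \<theta>_def)
  moreover have "\<bar>ball_average R f x\<bar> \<le> \<theta> * C"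
    if f: "continuous_on UNIV f" "periodic P f" "average f = 0" and C: "\<And>y. \<bar>f y\<bar> \<le> C" for f C x
  proof -
    have "integral cell (\<lambda>z. f (x + z)) = \<bar>det P\<bar> * average (\<lambda>z. f (x + z))"
      by (intro integral_cell continuous_shifted[OF f(1)] continuous_intros)
    also have "\<dots> = 0"
      using average_shift[OF f(1,2), of x] f(3) by (simp add: add.commute)
    finally have "ball_average R f x = integral ?K (\<lambda>z. G z * f (x + z))"
      using Gf_eq[OF f(1)] by simp
    also have "norm \<dots> \<le> integral ?K (\<lambda>z. G z * C)"
    proof (rule integral_norm_bound_integral[OF Gf[OF f(1)]])
      show "(\<lambda>z. G z * C) integrable_on ?K"
        using integrable_on_mult_left[OF G1] by blast
      show "norm (G z * f (x + z)) \<le> G z * C" for z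
        using G0[of z] C by (simp add: abs_mult mult_left_mono)
    qed
    finally show ?thesis
      using G1_eq by simp
  qed
  ultimately show thesis
    using R that by blast
qed

text \<open>With \<open>A\<close> the disc average and \<open>B\<close> its potential, \<open>B v + B (A v) + B (A (A v)) + \<dots>\<close> has the
  Laplacian \<open>(A v - v) + (A (A v) - A v) + \<dots>\<close>, which telescopes to \<open>- v\<close> since the iterates of \<open>A\<close>
  tend to zero geometrically on mean-zero fields. The operators commute with partial derivatives, and
  the partial derivatives of \<open>v\<close> up to order two have mean zero as well, so the series of second
  derivatives converges as fast as the series itself and the sum is twice continuously
  differentiable. Subtracting its average normalises it.\<close>

lemma poisson_solvable:
  assumes v: "C_class 2 v" "periodic P v" "average v = 0"
  obtains \<psi> where "periodic P \<psi>" "C_class 2 \<psi>" "average \<psi> = 0" "\<And>x. - laplacian \<psi> x = v x"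
proof -
  obtain R \<theta> where R: "R > 0" and \<theta>: "0 \<le> \<theta>" "\<theta> < 1"
    and contr: "\<And>f C x. \<lbrakk>continuous_on UNIV f; periodic P f; average f = 0; \<And>y. \<bar>f y\<bar> \<le> C\<rbrakk>
      \<Longrightarrow> \<bar>ball_average R f x\<bar> \<le> \<theta> * C"
    using ball_average_contraction by blast
  let ?A = "ball_average R" and ?B = "ball_potential R"
  have AC: "C_class m (?A f)" if "C_class m f" for m f
    unfolding ball_average_def by (intro C_class_smear ball_kernels_continuous continuous_on_id that)
  have BC: "C_class m (?B f)" if "C_class m f" for m f
    unfolding ball_potential_def by (intro C_class_smear ball_kernels_continuous that)
  have Ap: "partial i (?A f) = ?A (partial i f)" if "C_class 1 f" for i f
    unfolding ball_average_def using that
    by (intro ext partial_smear ball_kernels_continuous continuous_on_id)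
  have Bp: "partial i (?B f) = ?B (partial i f)" if "C_class 1 f" for i f
    unfolding ball_potential_def using that
    by (intro ext partial_smear ball_kernels_continuous)
  have Aper: "periodic P (?A f)" if "periodic P f" for f
    unfolding ball_average_def using that by (rule periodic_smear)
  have Bper: "periodic P (?B f)" if "periodic P f" for f
    unfolding ball_potential_def using that by (rule periodic_smear)
  have Aavg: "average (?A f) = 0" if "C_class 0 f" "periodic P f" "average f = 0" for f
    unfolding ball_average_def using that
    by (subst average_smear) (auto intro!: ball_kernels_continuous continuous_on_id)
  define M where "M = integral (cbox (0 :: real, vec (- (R + 1)) :: real ^ 2) (1, vec (R + 1)))
      (\<lambda>p. fst p * bump R (snd p) / bump_mass R)"
  have Bb: "\<bar>?B f x\<bar> \<le> M * C" if "C_class 0 f" "\<And>x. \<bar>f x\<bar> \<le> C" for f C x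
    unfolding ball_potential_def M_def using that bump_mass_pos[OF R]
    by (intro smear_bound ball_kernels_continuous)
       (auto simp: bump_nonneg cbox_Pair_eq intro!: divide_nonneg_nonneg mult_nonneg_nonneg)
  \<comment> \<open>The class on which \<open>A\<close> contracts; it is stable under \<open>A\<close>, and partial derivatives lower \<open>m\<close> by one.\<close>
  define mz where "mz m f \<longleftrightarrow> C_class m f \<and> periodic P f \<and> average f = 0" for m f
  have iter: "mz m ((?A ^^ n) f)" if "mz m f" for m n f
  proof (induction n)
    case (Suc n)
    then show ?case
      using AC Aper Aavg C_class_mono[of 0 m] by (auto simp: mz_def simp del: C_class.simps)
  qed (use that in simp)
  have iter_bound: "\<bar>(?A ^^ n) f x\<bar> \<le> \<theta> ^ n * C" if "mz 0 f" "\<And>x. \<bar>f x\<bar> \<le> C" for n f C x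
  proof (induction n arbitrary: x)
    case (Suc n)
    then show ?case
      using contr[of "(?A ^^ n) f" "\<theta> ^ n * C" x] iter[OF that(1), of n]
      by (simp add: mz_def ac_simps)
  qed (use that in simp)
  have mz_mono: "mz m f" if "mz n f" "m \<le> n" for m n f
    using that C_class_mono by (auto simp: mz_def)
  have mz_partial: "mz m (partial i f)" if "mz (Suc m) f" for m i f
  proof -
    have "C_class 1 f"
      using that C_class_mono[of 1 "Suc m"] by (auto simp: mz_def simp del: C_class.simps)
    then show ?thesis
      using that average_partial[of f i] periodic_partial[of f P i] C_class_1_D(1)[of f] C_class_partial[of m f i]
      by (simp add: mz_def del: C_class.simps)
  qed
  have iter_partial: "partial i ((?A ^^ n) f) = (?A ^^ n) (partial i f)" if "mz 1 f" for i n f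
  proof (induction n)
    case (Suc n)
    then show ?case
      using Ap[of "(?A ^^ n) f"] iter[OF that, of n] by (simp add: mz_def)
  qed simp
  have mzv: "mz 2 v" using v by (simp add: mz_def)
  have mzv1: "mz 1 v" "mz 0 v" "mz 1 (partial i v)" "mz 0 (partial i v)" "mz 0 (partial j (partial i v))" for i j
    using mz_mono[OF mzv] mz_partial[of 1 v i] mzv mz_partial[of 0 "partial i v" j] mz_mono[of 1 "partial i v" 0]
    by (auto simp: numeral_2_eq_2)
  have "\<exists>C. \<forall>x. \<bar>f x\<bar> \<le> C" if "mz 0 f" for f
    using periodic_bounded[of f] that by (auto simp: mz_def)
  then obtain C where C: "\<And>f x. mz 0 f \<Longrightarrow> \<bar>f x\<bar> \<le> C f"
    by metis
  \<comment> \<open>Differentiating the series needs one summable majorant for the values and the partial derivatives.\<close>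
  define D where "D = Max (insert (C v) ((\<lambda>i. C (partial i v)) ` UNIV \<union> (\<lambda>(i, j). C (partial j (partial i v))) ` UNIV))"
  have D: "C v \<le> D" "C (partial i v) \<le> D" "C (partial j (partial i v)) \<le> D" for i j
    unfolding D_def by (intro Max_ge; auto)+
  have bound: "\<bar>?B ((?A ^^ n) f) x\<bar> \<le> M * (\<theta> ^ n * D)" if "mz 0 f" "C f \<le> D" for f n x
  proof (rule Bb)
    show "C_class 0 ((?A ^^ n) f)"
      using iter[OF that(1)] by (simp add: mz_def)
    show "\<bar>(?A ^^ n) f x\<bar> \<le> \<theta> ^ n * D" for x
      using iter_bound[OF that(1), of D] C[OF that(1)] that(2) order_trans by blast
  qed
  have summ: "summable (\<lambda>n. M * (\<theta> ^ n * D))"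
    using \<theta> by (intro summable_mult summable_mult2 summable_geometric) auto
  define u where "u f n = ?B ((?A ^^ n) f)" for f n
  have u_bound: "\<bar>u f n x\<bar> \<le> M * (\<theta> ^ n * D)" if "mz 0 f" "C f \<le> D" for f n x
    using bound[OF that] by (simp add: u_def)
  have u_partial: "partial i (u f n) = u (partial i f) n" if "mz 1 f" for i f n
    using Bp[of "(?A ^^ n) f"] iter[OF that, of n] iter_partial[OF that] by (simp add: u_def mz_def)
  have u_C: "C_class m (u f n)" if "mz m f" for m f n
    using BC iter[OF that, of n] by (auto simp: u_def mz_def)
  have series: "(\<lambda>x. \<Sum>n. u f n x) differentiable (at x)"
      "partial i (\<lambda>x. \<Sum>n. u f n x) = (\<lambda>x. \<Sum>n. u (partial i f) n x)"
    if "mz 1 f" "C f \<le> D" "\<And>i. C (partial i f) \<le> D" for f i x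
  proof -
    have f0: "mz 0 f" "mz 0 (partial i f)" for i
      using mz_mono[OF that(1)] mz_partial[of 0 f i] that(1) by auto
    have d: "u f n differentiable (at x)" for n x
      using u_C[OF that(1)] C_class_1_D(1) by blast
    have b: "\<bar>partial i (u f n) x\<bar> \<le> M * (\<theta> ^ n * D)" for i n x
      using u_bound[OF f0(2) that(3)] u_partial[OF that(1)] by simp
    note ps = partial_series[OF d u_bound[OF f0(1) that(2)] b summ]
    show "(\<lambda>x. \<Sum>n. u f n x) differentiable (at x)"
      by (rule ps(1))
    show "partial i (\<lambda>x. \<Sum>n. u f n x) = (\<lambda>x. \<Sum>n. u (partial i f) n x)"
      using ps(2) u_partial[OF that(1)] by (simp add: fun_eq_iff)
  qed
  define \<psi> where "\<psi> x = (\<Sum>n. u v n x)" for x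
  note s1 = series[OF mzv1(1) D(1,2), folded \<psi>_def[abs_def]]
  note s2 = series[OF mzv1(3) D(2,3)]
  have C2: "C_class 2 \<psi>"
  proof -
    have "continuous_on UNIV (\<lambda>x. \<Sum>n. u (partial j (partial i v)) n x)" for i j
      by (rule continuous_series[OF _ u_bound[OF mzv1(5) D(3)] summ])
         (use u_C[OF mzv1(5)] in simp)
    then show ?thesis
      using s1 s2 by (simp add: numeral_2_eq_2)
  qed
  have per: "periodic P \<psi>"
  proof -
    have "periodic P (u v n)" for n
      using iter[OF mzv, of n] Bper by (simp add: u_def mz_def)
    then show ?thesis
      by (simp add: periodic_def \<psi>_def)
  qed
  have lap: "laplacian \<psi> x = - v x" for x
  proof -
    have sm: "summable (\<lambda>n. u (partial i (partial i v)) n x)" for i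
      by (rule summable_comparison_test'[OF summ]) (use u_bound[OF mzv1(5) D(3)] in auto)
    have "laplacian \<psi> x = (\<Sum>i\<in>UNIV. \<Sum>n. u (partial i (partial i v)) n x)"
      by (simp add: laplacian_def s1 s2)
    also have "\<dots> = (\<Sum>n. \<Sum>i\<in>UNIV. u (partial i (partial i v)) n x)"
      using sm by (intro suminf_sum[symmetric]) auto
    also have "(\<lambda>n. \<Sum>i\<in>UNIV. u (partial i (partial i v)) n x) = (\<lambda>n. (?A ^^ Suc n) v x - (?A ^^ n) v x)"
    proof
      fix n
      have "(\<Sum>i\<in>UNIV. u (partial i (partial i v)) n x) = laplacian (u v n) x"
        by (simp only: laplacian_def u_partial[OF mzv1(1)] u_partial[OF mzv1(3)])
      also have "\<dots> = ?A ((?A ^^ n) v) x - (?A ^^ n) v x"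
        using laplacian_ball_potential[OF _ R] iter[OF mzv, of n] by (simp add: u_def mz_def)
      finally show "(\<Sum>i\<in>UNIV. u (partial i (partial i v)) n x) = (?A ^^ Suc n) v x - (?A ^^ n) v x"
        by simp
    qed
    also have "suminf \<dots> = 0 - (?A ^^ 0) v x"
    proof (rule sums_unique[symmetric], rule telescope_sums)
      have "(\<lambda>n. \<theta> ^ n * C v) \<longlonglongrightarrow> 0"
        using \<theta> by (intro tendsto_mult_left_zero LIMSEQ_power_zero) auto
      then show "(\<lambda>n. (?A ^^ n) v x) \<longlonglongrightarrow> 0"
        by (rule Lim_null_comparison[rotated])
           (use iter_bound[OF mzv1(2) C[OF mzv1(2)]] in \<open>auto intro!: always_eventually\<close>)
    qed
    finally show ?thesis by simp
  qed
  define \<psi>0 where "\<psi>0 x = 1 * \<psi> x + (- average \<psi>) * 1" for x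
  have one: "C_class 2 (\<lambda>_. 1)" "periodic P (\<lambda>_. 1)"
    by (rule C_class_const) (simp add: periodic_def)
  show thesis
  proof (rule that[of \<psi>0])
    show "periodic P \<psi>0"
      unfolding \<psi>0_def[abs_def] by (intro periodic_lincomb per one)
    show "C_class 2 \<psi>0"
      unfolding \<psi>0_def[abs_def] by (intro C_class_lincomb C2 one)
    show "average \<psi>0 = 0"
      unfolding \<psi>0_def[abs_def]
      by (subst average_lincomb) (auto simp: average_const intro: C_class_continuous[OF C2])
    show "- laplacian \<psi>0 x = v x" for x
      unfolding \<psi>0_def[abs_def] laplacian_lincomb[OF C2 one(1)]
      by (simp add: laplacian_const lap)
  qed
qed

end

section \<open>Gradient structure of the BDF formulas\<close>

lemma bdf_kernel_3: "bdf_kernel 3 = coeff [:11/6, -7/6, 1/3:]"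
  unfolding bdf_kernel_def by (simp add: numeral_eq_Suc sum.nat_ivl_Suc')

lemma bdf_kernel_4: "bdf_kernel 4 = coeff [:25/12, -23/12, 13/12, -1/4:]"
  unfolding bdf_kernel_def by (simp add: numeral_eq_Suc sum.nat_ivl_Suc')

lemma bdf_kernel_5: "bdf_kernel 5 = coeff [:137/60, -163/60, 137/60, -21/20, 1/5:]"
  unfolding bdf_kernel_def by (simp add: numeral_eq_Suc sum.nat_ivl_Suc')

lemma bdf_kernel_eq_0:
  assumes "k \<in> {3, 4, 5}" "k \<le> j"
  shows "bdf_kernel k j = 0"
  using assms by (auto simp: bdf_kernel_3 bdf_kernel_4 bdf_kernel_5 intro!: coeff_eq_0)

lemma bdf_kernel_0_pos: "k \<in> {3, 4, 5} \<Longrightarrow> bdf_kernel k 0 > 0"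
  by (auto simp: bdf_kernel_3 bdf_kernel_4 bdf_kernel_5)

lemma BDF_eq:
  assumes "k \<in> {3, 4, 5}" "k \<le> n"
  shows "BDF k \<tau> \<phi> n x = 1 / \<tau> * (\<Sum>i<k. bdf_kernel k i * nabla_tau \<phi> (n - i) x)"
proof -
  have "(\<Sum>j = 1..n. bdf_kernel k (n - j) * nabla_tau \<phi> j x) = (\<Sum>i<n. bdf_kernel k i * nabla_tau \<phi> (n - i) x)"
    by (rule sum.reindex_bij_witness[of _ "\<lambda>i. n - i" "\<lambda>j. n - j"]) auto
  also have "\<dots> = (\<Sum>i<k. bdf_kernel k i * nabla_tau \<phi> (n - i) x)"
    using assms by (intro sum.mono_neutral_right) (auto simp: bdf_kernel_eq_0)
  finally show ?thesis by (simp add: BDF_def)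
qed

text \<open>The square of the norm of the combination with coefficients \<open>a\<close>, for vectors with Gram matrix \<open>g\<close>.
  In this form the identity behind the modified energy becomes one between finitely many numbers.\<close>

definition gram :: "(nat \<Rightarrow> nat \<Rightarrow> real) \<Rightarrow> real list \<Rightarrow> real" where
  "gram g a = (\<Sum>i<length a. \<Sum>j<length a. a ! i * a ! j * g i j)"

text \<open>The functional of order \<open>k\<close> as a function of coefficient lists: \<open>q a\<close> stands for the square of the
  combination of \<open>v\<^sub>n, v\<^sub>n\<^sub>-\<^sub>1, \<dots>\<close> with the coefficients \<open>a\<close>. Prefixing a zero to \<open>a\<close> passes from
  level \<open>n\<close> to level \<open>n - 1\<close>.\<close>

definition gram_G :: "nat \<Rightarrow> (real list \<Rightarrow> real) \<Rightarrow> real" where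
  "gram_G k q =
    (if k = 3 then 1/6 * q [1] + 1/6 * q [7/4, -1]
     else if k = 4 then 13627/43008 * q [1] + 7/24 * q [65/56, -1] + 1/8 * q [3/2, -3/2, 1]
     else if k = 5 then 1198850903/1678080000 * q [1] + 437/900 * q [4931/6992, -1]
       + 9/40 * q [23/18, -23/18, 1] + 1/10 * q [2, -2, 2, -1]
     else 0)"

text \<open>The difference of the two sides is a positive combination of squares. The squares are those found
  by completing the square successively, starting with the oldest increment; \<open>sigma_L k\<close> is exactly the
  number for which nothing is left over at the end.\<close>

lemma bdf_gradient_structure:
  assumes k: "k \<in> {3, 4, 5}" and sym: "\<And>i j. g i j = g j i" and psd: "\<And>a. length a \<le> k \<Longrightarrow> 0 \<le> gram g a"
  shows "gram_G k (gram g) - gram_G k (\<lambda>a. gram g (0 # a)) + sigma_L k / 2 * g 0 0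
    \<le> (\<Sum>i<k. bdf_kernel k i * g 0 i)"
proof -
  have s: "g (Suc i) 0 = g 0 (Suc i)" "g (Suc (Suc i)) (Suc 0) = g (Suc 0) (Suc (Suc i))"
      "g (Suc (Suc (Suc i))) (Suc (Suc 0)) = g (Suc (Suc 0)) (Suc (Suc (Suc i)))"
      "g (Suc (Suc (Suc (Suc i)))) (Suc (Suc (Suc 0))) = g (Suc (Suc (Suc 0))) (Suc (Suc (Suc (Suc i))))" for i
    by (rule sym)+
  consider "k = 3" | "k = 4" | "k = 5" using k by auto
  then show ?thesis
  proof cases
    case 1
    have "0 \<le> 1/6 * gram g [1, -7/4, 1]"
      using psd 1 by simp
    also have "\<dots> = (\<Sum>i<k. bdf_kernel k i * g 0 i)
        - (gram_G k (gram g) - gram_G k (\<lambda>a. gram g (0 # a)) + sigma_L k / 2 * g 0 0)"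
      unfolding 1 gram_def gram_G_def sigma_L_def bdf_kernel_3
      by (simp add: numeral_eq_Suc s field_simps)
    finally show ?thesis by simp
  next
    case 2
    have "0 \<le> 1/8 * gram g [-1, 3/2, -3/2, 1] + 1/6 * gram g [1, -29/32, 1]"
      using psd 2 by simp
    also have "\<dots> = (\<Sum>i<k. bdf_kernel k i * g 0 i)
        - (gram_G k (gram g) - gram_G k (\<lambda>a. gram g (0 # a)) + sigma_L k / 2 * g 0 0)"
      unfolding 2 gram_def gram_G_def sigma_L_def bdf_kernel_4
      by (simp add: numeral_eq_Suc s field_simps)
    finally show ?thesis by simp
  next
    case 3
    have "0 \<le> 1/10 * gram g [1, -2, 2, -2, 1] + 1/8 * gram g [-1, 7/10, -7/10, 1] + 1/6 * gram g [1, 187/800, 1]"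
      using psd 3 by simp
    also have "\<dots> = (\<Sum>i<k. bdf_kernel k i * g 0 i)
        - (gram_G k (gram g) - gram_G k (\<lambda>a. gram g (0 # a)) + sigma_L k / 2 * g 0 0)"
      unfolding 3 gram_def gram_G_def sigma_L_def bdf_kernel_5
      by (simp add: numeral_eq_Suc s field_simps)
    finally show ?thesis by simp
  qed
qed

lemma G_functional_eq_gram_G:
  assumes "k \<in> {3, 4, 5}"
  shows "G_functional k sq v n = gram_G k (\<lambda>a. sq (\<lambda>x. \<Sum>i<length a. a ! i * v (n - i) x))"
proof -
  have e: "(\<lambda>x. \<Sum>i<length [a]. [a] ! i * v (n - i) x) = (\<lambda>x. a * v n x)"
    "(\<lambda>x. \<Sum>i<length [a, b]. [a, b] ! i * v (n - i) x) = (\<lambda>x. a * v n x + b * v (n - 1) x)"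
    "(\<lambda>x. \<Sum>i<length [a, b, d]. [a, b, d] ! i * v (n - i) x) = (\<lambda>x. a * v n x + b * v (n - 1) x + d * v (n - 2) x)"
    "(\<lambda>x. \<Sum>i<length [a, b, d, e]. [a, b, d, e] ! i * v (n - i) x)
      = (\<lambda>x. a * v n x + b * v (n - 1) x + d * v (n - 2) x + e * v (n - 3) x)" for a b d e
    by (simp_all add: numeral_eq_Suc)
  show ?thesis
    unfolding G_functional_def gram_G_def e by (simp add: algebra_simps diff_divide_distrib)
qed


section \<open>The H^-1 inner product of mean-zero fields\<close>

context lattice_cell
begin

definition mean_zero_field :: "field2 \<Rightarrow> bool" where
  "mean_zero_field v \<longleftrightarrow> C_class 2 v \<and> periodic P v \<and> average v = 0"

lemma inner_L2_cell:
  assumes "continuous_on UNIV f" "continuous_on UNIV g"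
  shows "inner_L2 cell f g = \<bar>det P\<bar> * average (\<lambda>x. f x * g x)"
  unfolding inner_L2_def by (intro integral_cell continuous_intros assms)

lemma norm_L2_cell_sq:
  assumes f: "continuous_on UNIV f"
  shows "(norm_L2 cell f)\<^sup>2 = \<bar>det P\<bar> * average (\<lambda>x. (f x)\<^sup>2)"
proof -
  have "0 \<le> average (\<lambda>x. f x * f x)"
    by (intro average_nonneg continuous_intros f) simp
  then show ?thesis
    by (simp add: norm_L2_def inner_L2_cell[OF f f] power2_eq_square)
qed

lemma inv_neg_laplacian_eqI:
  assumes "mean_zero_field \<psi>" "\<And>x. - laplacian \<psi> x = v x"
  shows "inv_neg_laplacian P cell v = \<psi>"
  unfolding inv_neg_laplacian_def
proof (rule the_equality)
  have avg: "inner_L2 cell f (\<lambda>_. 1) = 0 \<longleftrightarrow> average f = 0" if "C_class 2 f" for f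
    using inner_L2_cell[OF C_class_continuous[OF that] continuous_on_const[of _ 1]] det_nonzero by simp
  show "periodic P \<psi> \<and> C_class 2 \<psi> \<and> inner_L2 cell \<psi> (\<lambda>_. 1) = 0 \<and> (\<forall>x. - laplacian \<psi> x = v x)"
    using assms avg by (auto simp: mean_zero_field_def)
  fix \<xi>
  assume \<xi>: "periodic P \<xi> \<and> C_class 2 \<xi> \<and> inner_L2 cell \<xi> (\<lambda>_. 1) = 0 \<and> (\<forall>x. - laplacian \<xi> x = v x)"
  let ?d = "\<lambda>x. 1 * \<xi> x + (-1) * \<psi> x"
  have c2: "C_class 2 \<xi>" "C_class 2 \<psi>" and p: "periodic P \<xi>" "periodic P \<psi>"
    and a: "average \<xi> = 0" "average \<psi> = 0"
    using \<xi> assms(1) avg by (auto simp: mean_zero_field_def)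
  have "average ?d = 1 * average \<xi> + (-1) * average \<psi>"
    by (intro average_lincomb c2[THEN C_class_continuous])
  then have "average ?d = 0"
    using a by simp
  moreover have "laplacian ?d x = 0" for x
  proof -
    have "- laplacian \<xi> x = - laplacian \<psi> x"
      using \<xi> assms(2) by simp
    then show ?thesis
      unfolding laplacian_lincomb[OF c2] by simp
  qed
  ultimately have "?d x = 0" for x
    using harmonic_imp_constant[of ?d x] C_class_lincomb[OF c2] periodic_lincomb[OF p] by metis
  then show "\<xi> = \<psi>"
    by (simp add: fun_eq_iff)
qed

lemma mean_zero_field_lincomb:
  assumes "mean_zero_field v" "mean_zero_field w"
  shows "mean_zero_field (\<lambda>x. a * v x + b * w x)"
  using assms average_lincomb[of v w a b] C_class_continuous[of 2]
  by (auto simp: mean_zero_field_def intro: C_class_lincomb periodic_lincomb)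

lemma inv_neg_laplacian:
  assumes "mean_zero_field v"
  shows "mean_zero_field (inv_neg_laplacian P cell v)"
    and "laplacian (inv_neg_laplacian P cell v) x = - v x"
proof -
  obtain \<psi> where \<psi>: "periodic P \<psi>" "C_class 2 \<psi>" "average \<psi> = 0" "\<And>x. - laplacian \<psi> x = v x"
    using poisson_solvable assms unfolding mean_zero_field_def by metis
  then have m: "mean_zero_field \<psi>"
    by (simp add: mean_zero_field_def)
  have e: "inv_neg_laplacian P cell v = \<psi>"
    by (rule inv_neg_laplacian_eqI[OF m \<psi>(4)])
  show "mean_zero_field (inv_neg_laplacian P cell v)"
    unfolding e by (rule m)
  show "laplacian (inv_neg_laplacian P cell v) x = - v x"
    using \<psi>(4)[of x] unfolding e by simp
qed

lemma mean_zero_field_continuous: "mean_zero_field v \<Longrightarrow> continuous_on UNIV v"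
  by (auto simp: mean_zero_field_def intro: C_class_continuous)

lemma inner_m1_eq:
  assumes "mean_zero_field v" "continuous_on UNIV w"
  shows "inner_m1 P cell v w = \<bar>det P\<bar> * average (\<lambda>x. inv_neg_laplacian P cell v x * w x)"
  unfolding inner_m1_def
  by (intro inner_L2_cell assms mean_zero_field_continuous inv_neg_laplacian)

lemma inner_m1_lincomb_right:
  assumes "mean_zero_field u" "mean_zero_field v" "mean_zero_field w"
  shows "inner_m1 P cell u (\<lambda>x. a * v x + b * w x) = a * inner_m1 P cell u v + b * inner_m1 P cell u w"
proof -
  let ?\<psi> = "inv_neg_laplacian P cell u"
  note c = mean_zero_field_continuous[OF inv_neg_laplacian(1)[OF assms(1)]]
    mean_zero_field_continuous[OF assms(2)] mean_zero_field_continuous[OF assms(3)]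
  have "average (\<lambda>x. ?\<psi> x * (a * v x + b * w x)) = average (\<lambda>x. a * (?\<psi> x * v x) + b * (?\<psi> x * w x))"
    by (simp add: algebra_simps)
  also have "\<dots> = a * average (\<lambda>x. ?\<psi> x * v x) + b * average (\<lambda>x. ?\<psi> x * w x)"
    by (intro average_lincomb continuous_intros c)
  finally show ?thesis
    using c by (simp add: inner_m1_eq assms continuous_intros algebra_simps)
qed

text \<open>Up to a common factor, both sides are averages of products of one potential with the Laplacian
  of the other, and Green's identity is symmetric in the two.\<close>

lemma inner_m1_symmetric:
  assumes v: "mean_zero_field v" and w: "mean_zero_field w"
  shows "inner_m1 P cell v w = inner_m1 P cell w v"
proof -
  let ?\<psi> = "inv_neg_laplacian P cell v" and ?\<xi> = "inv_neg_laplacian P cell w"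
  have "average (\<lambda>x. laplacian ?\<psi> x * ?\<xi> x) = average (\<lambda>x. ?\<psi> x * laplacian ?\<xi> x)"
    using inv_neg_laplacian(1)[OF v] inv_neg_laplacian(1)[OF w]
    by (intro average_laplacian_symmetric) (auto simp: mean_zero_field_def)
  then have "average (\<lambda>x. - 1 * (v x * ?\<xi> x) + 0 * (v x * ?\<xi> x)) = average (\<lambda>x. - 1 * (?\<psi> x * w x) + 0 * (?\<psi> x * w x))"
    by (simp add: inv_neg_laplacian v w)
  moreover note c = mean_zero_field_continuous[OF v] mean_zero_field_continuous[OF w]
     mean_zero_field_continuous[OF inv_neg_laplacian(1)[OF v]] mean_zero_field_continuous[OF inv_neg_laplacian(1)[OF w]]
  have "average (\<lambda>x. - 1 * (v x * ?\<xi> x) + 0 * (v x * ?\<xi> x)) = - 1 * average (\<lambda>x. v x * ?\<xi> x) + 0 * average (\<lambda>x. v x * ?\<xi> x)"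
    "average (\<lambda>x. - 1 * (?\<psi> x * w x) + 0 * (?\<psi> x * w x)) = - 1 * average (\<lambda>x. ?\<psi> x * w x) + 0 * average (\<lambda>x. ?\<psi> x * w x)"
    by (intro average_lincomb continuous_intros c)+
  ultimately show ?thesis
    using c by (simp add: inner_m1_eq v w mult.commute)
qed

lemma inner_m1_nonneg:
  assumes v: "mean_zero_field v"
  shows "0 \<le> inner_m1 P cell v v"
proof -
  let ?\<psi> = "inv_neg_laplacian P cell v"
  have "average (\<lambda>x. laplacian ?\<psi> x * ?\<psi> x) \<le> 0"
    using inv_neg_laplacian(1)[OF v]
    by (intro average_laplacian_nonpos) (auto simp: mean_zero_field_def)
  moreover note c = mean_zero_field_continuous[OF v] mean_zero_field_continuous[OF inv_neg_laplacian(1)[OF v]]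
  have "average (\<lambda>x. - 1 * (?\<psi> x * v x) + 0 * (?\<psi> x * v x)) = - 1 * average (\<lambda>x. ?\<psi> x * v x) + 0 * average (\<lambda>x. ?\<psi> x * v x)"
    by (intro average_lincomb continuous_intros c)
  ultimately show ?thesis
    using c by (simp add: inner_m1_eq v inv_neg_laplacian mult.commute)
qed

lemma norm_m1_sq: "mean_zero_field v \<Longrightarrow> (norm_m1 P cell v)\<^sup>2 = inner_m1 P cell v v"
  by (simp add: norm_m1_def inner_m1_nonneg)

lemma mean_zero_field_sum:
  fixes m :: nat
  assumes "\<And>i. i < m \<Longrightarrow> mean_zero_field (w i)"
  shows "mean_zero_field (\<lambda>x. \<Sum>i<m. a i * w i x)"
  using assms
proof (induction m)
  case 0
  then show ?case by (simp add: mean_zero_field_def C_class_const periodic_def average_const)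
next
  case (Suc m)
  then show ?case
    using mean_zero_field_lincomb[of "\<lambda>x. \<Sum>i<m. a i * w i x" "w m" 1 "a m"] by simp
qed

lemma inner_m1_sum_right:
  fixes m :: nat
  assumes u: "mean_zero_field u" and "\<And>i. i < m \<Longrightarrow> mean_zero_field (w i)"
  shows "inner_m1 P cell u (\<lambda>x. \<Sum>i<m. a i * w i x) = (\<Sum>i<m. a i * inner_m1 P cell u (w i))"
  using assms(2)
proof (induction m)
  case 0
  then show ?case by (simp add: inner_m1_def inner_L2_def)
next
  case (Suc m)
  have "inner_m1 P cell u (\<lambda>x. 1 * (\<Sum>i<m. a i * w i x) + a m * w m x)
      = 1 * inner_m1 P cell u (\<lambda>x. \<Sum>i<m. a i * w i x) + a m * inner_m1 P cell u (w m)"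
    using Suc.prems by (intro inner_m1_lincomb_right u mean_zero_field_sum) auto
  with Suc show ?case
    by simp
qed

lemma norm_m1_sq_sum:
  assumes w: "\<And>i. i < length a \<Longrightarrow> mean_zero_field (w i)"
  shows "(norm_m1 P cell (\<lambda>x. \<Sum>i<length a. a ! i * w i x))\<^sup>2 = gram (\<lambda>i j. inner_m1 P cell (w i) (w j)) a"
proof -
  let ?s = "\<lambda>x. \<Sum>i<length a. a ! i * w i x"
  have s: "mean_zero_field ?s"
    using w by (rule mean_zero_field_sum)
  have "inner_m1 P cell ?s ?s = (\<Sum>i<length a. a ! i * inner_m1 P cell ?s (w i))"
    using inner_m1_sum_right[OF s w] .
  also have "\<dots> = (\<Sum>i<length a. a ! i * (\<Sum>j<length a. a ! j * inner_m1 P cell (w i) (w j)))"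
  proof (rule sum.cong)
    fix i assume i: "i \<in> {..<length a}"
    have "inner_m1 P cell ?s (w i) = inner_m1 P cell (w i) ?s"
      using i by (intro inner_m1_symmetric s w) simp
    also have "\<dots> = (\<Sum>j<length a. a ! j * inner_m1 P cell (w i) (w j))"
      using i by (intro inner_m1_sum_right w) auto
    finally show "a ! i * inner_m1 P cell ?s (w i) = a ! i * (\<Sum>j<length a. a ! j * inner_m1 P cell (w i) (w j))"
      by simp
  qed simp
  finally show ?thesis
    by (simp add: norm_m1_sq[OF s] gram_def sum_distrib_left mult.assoc)
qed

end

section \<open>The energy along one step\<close>

context lattice_cell
begin

lemma continuous_one_plus_laplacian: "C_class 2 f \<Longrightarrow> continuous_on UNIV (one_plus_laplacian f)"
  using C_class_laplacian[of 0 f] C_class_continuous[of 2 f]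
  unfolding one_plus_laplacian_def[abs_def] by (auto simp: numeral_2_eq_2 intro!: continuous_intros)

lemma energy_cell:
  assumes f: "C_class 2 f"
  shows "energy cell \<epsilon> f = \<bar>det P\<bar> * (1 / 2 * average (\<lambda>x. (one_plus_laplacian f x)\<^sup>2)
     + 1 / 4 * average (\<lambda>x. ((f x)\<^sup>2 - \<epsilon>)\<^sup>2) - 1 / 4 * average (\<lambda>x. \<epsilon>\<^sup>2))"
proof -
  have "continuous_on UNIV (\<lambda>x. (f x)\<^sup>2 - \<epsilon>)"
    by (intro continuous_intros C_class_continuous[OF f])
  then show ?thesis
    unfolding energy_def
    by (simp add: norm_L2_cell_sq continuous_one_plus_laplacian[OF f] algebra_simps)
qed

text \<open>Bundling continuity with the value of the average lets averages of long sums be computed by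
  introduction rules.\<close>

definition has_average :: "field2 \<Rightarrow> real \<Rightarrow> bool" where
  "has_average f a \<longleftrightarrow> continuous_on UNIV f \<and> average f = a"

lemma has_averageI: "continuous_on UNIV f \<Longrightarrow> has_average f (average f)"
  by (simp add: has_average_def)

lemma has_average_lincomb:
  "has_average f a \<Longrightarrow> has_average g b \<Longrightarrow> has_average (\<lambda>x. r * f x + s * g x) (r * a + s * b)"
  by (auto simp: has_average_def average_lincomb intro!: continuous_intros)

lemma has_average_add: "has_average f a \<Longrightarrow> has_average g b \<Longrightarrow> has_average (\<lambda>x. f x + g x) (a + b)"
  using has_average_lincomb[of f a g b 1 1] by simp

lemma has_average_diff: "has_average f a \<Longrightarrow> has_average g b \<Longrightarrow> has_average (\<lambda>x. f x - g x) (a - b)"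
  using has_average_lincomb[of f a g b 1 "-1"] by simp

lemma has_average_cmult: "has_average f a \<Longrightarrow> has_average (\<lambda>x. r * f x) (r * a)"
  using has_average_lincomb[of f a f a r 0] by simp

lemma has_average_sum:
  fixes m :: nat
  assumes "\<And>i. i < m \<Longrightarrow> has_average (f i) (a i)"
  shows "has_average (\<lambda>x. \<Sum>i<m. f i x) (\<Sum>i<m. a i)"
  using assms
proof (induction m)
  case 0
  then show ?case by (simp add: has_average_def average_const)
next
  case (Suc m)
  then show ?case
    using has_average_add[of "\<lambda>x. \<Sum>i<m. f i x" _ "f m" "a m"] by simp
qed

lemma has_average_nonneg: "has_average f a \<Longrightarrow> (\<And>x. 0 \<le> f x) \<Longrightarrow> 0 \<le> a"
  using average_nonneg by (auto simp: has_average_def)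

lemmas has_average_intros = has_average_add has_average_diff has_average_cmult

text \<open>After moving one factor of the squared operator onto \<open>v\<close>, the inequality holds pointwise: the
  quadratic parts follow from \<open>2 * a * (a - b) = a\<^sup>2 - b\<^sup>2 + (a - b)\<^sup>2\<close>, and the quartic part from
  \<open>4 * u ^ 3 * (u - w) = u ^ 4 - w ^ 4 + (u\<^sup>2 - w\<^sup>2)\<^sup>2 + 2 * u\<^sup>2 * (u - w)\<^sup>2\<close>, whose last two terms
  are dropped.\<close>

lemma energy_difference_le:
  assumes u: "C_class 4 u" "periodic P u" and w: "C_class 2 w" "periodic P w"
    and \<mu>: "\<And>x. \<mu> x = one_plus_laplacian (one_plus_laplacian u) x + (u x) ^ 3 - \<epsilon> * u x"
  defines "v \<equiv> \<lambda>x. u x - w x"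
  shows "energy cell \<epsilon> u - energy cell \<epsilon> w \<le> \<bar>det P\<bar> *
    (average (\<lambda>x. \<mu> x * v x) - 1 / 2 * average (\<lambda>x. (one_plus_laplacian v x)\<^sup>2) + \<epsilon> / 2 * average (\<lambda>x. (v x)\<^sup>2))"
proof -
  let ?L = one_plus_laplacian
  have u2: "C_class 2 u" using u(1) by (rule C_class_mono[rotated]) simp
  have v_eq: "v = (\<lambda>x. 1 * u x + (-1) * w x)" by (simp add: v_def)
  have v2: "C_class 2 v" and vp: "periodic P v"
    unfolding v_eq by (intro C_class_lincomb u2 w, intro periodic_lincomb u w)
  have Lu2: "C_class 2 (?L u)"
  proof -
    have "?L u = (\<lambda>x. 1 * u x + 1 * laplacian u x)"
      by (simp add: fun_eq_iff one_plus_laplacian_def)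
    then show ?thesis
      using C_class_lincomb[OF u2, of "laplacian u" 1 1] C_class_laplacian[of 2 u] u(1) 
      by (simp add: numeral_eq_Suc)
  qed
  have Lup: "periodic P (?L u)"
    using u(2) periodic_laplacian[OF u2 u(2)] by (simp add: periodic_def one_plus_laplacian_def)
  have Lv: "?L v x = ?L u x - ?L w x" for x
    unfolding v_eq one_plus_laplacian_def laplacian_lincomb[OF u2 w(1)] by simp
  note c = C_class_continuous[OF u2] C_class_continuous[OF w(1)] C_class_continuous[OF v2]
    C_class_continuous[OF Lu2] continuous_one_plus_laplacian[OF w(1)] continuous_one_plus_laplacian[OF v2]
    continuous_one_plus_laplacian[OF Lu2]
  have lc: "continuous_on UNIV (laplacian v)" "continuous_on UNIV (laplacian (?L u))"
    using C_class_laplacian[of 0] v2 Lu2 by (auto simp: numeral_2_eq_2)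
  have "has_average (\<lambda>x. ?L u x * v x + laplacian (?L u) x * v x)
      (average (\<lambda>x. ?L u x * v x) + average (\<lambda>x. laplacian (?L u) x * v x))"
    "has_average (\<lambda>x. ?L u x * v x + ?L u x * laplacian v x)
      (average (\<lambda>x. ?L u x * v x) + average (\<lambda>x. ?L u x * laplacian v x))"
    by (intro has_average_add has_averageI continuous_intros c lc)+
  then have sym: "average (\<lambda>x. ?L (?L u) x * v x) = average (\<lambda>x. ?L u x * ?L v x)"
    using average_laplacian_symmetric[OF Lu2 Lup v2 vp]
    by (simp add: has_average_def one_plus_laplacian_def[of "?L u"] one_plus_laplacian_def[of v] algebra_simps)
  have \<mu>_avg: "average (\<lambda>x. \<mu> x * v x) = average (\<lambda>x. ?L u x * ?L v x) + average (\<lambda>x. ((u x) ^ 3 - \<epsilon> * u x) * v x)"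
  proof -
    have "has_average (\<lambda>x. ?L (?L u) x * v x + ((u x) ^ 3 - \<epsilon> * u x) * v x)
       (average (\<lambda>x. ?L (?L u) x * v x) + average (\<lambda>x. ((u x) ^ 3 - \<epsilon> * u x) * v x))"
      by (intro has_average_add has_averageI continuous_intros c)
    then show ?thesis
      using sym by (simp add: has_average_def \<mu> algebra_simps)
  qed
  have "has_average (\<lambda>x. (?L u x * ?L v x + ((u x) ^ 3 - \<epsilon> * u x) * v x) - 1 / 2 * (?L v x)\<^sup>2 + \<epsilon> / 2 * (v x)\<^sup>2
      - (1 / 2 * (?L u x)\<^sup>2 + 1 / 4 * ((u x)\<^sup>2 - \<epsilon>)\<^sup>2 - 1 / 4 * \<epsilon>\<^sup>2)
      + (1 / 2 * (?L w x)\<^sup>2 + 1 / 4 * ((w x)\<^sup>2 - \<epsilon>)\<^sup>2 - 1 / 4 * \<epsilon>\<^sup>2))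
     ((average (\<lambda>x. ?L u x * ?L v x) + average (\<lambda>x. ((u x) ^ 3 - \<epsilon> * u x) * v x))
      - 1 / 2 * average (\<lambda>x. (?L v x)\<^sup>2) + \<epsilon> / 2 * average (\<lambda>x. (v x)\<^sup>2)
      - (1 / 2 * average (\<lambda>x. (?L u x)\<^sup>2) + 1 / 4 * average (\<lambda>x. ((u x)\<^sup>2 - \<epsilon>)\<^sup>2) - 1 / 4 * average (\<lambda>x. \<epsilon>\<^sup>2))
      + (1 / 2 * average (\<lambda>x. (?L w x)\<^sup>2) + 1 / 4 * average (\<lambda>x. ((w x)\<^sup>2 - \<epsilon>)\<^sup>2) - 1 / 4 * average (\<lambda>x. \<epsilon>\<^sup>2)))"
    by (intro has_average_intros; intro has_averageI continuous_intros c)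
  then have "0 \<le> (average (\<lambda>x. ?L u x * ?L v x) + average (\<lambda>x. ((u x) ^ 3 - \<epsilon> * u x) * v x))
      - 1 / 2 * average (\<lambda>x. (?L v x)\<^sup>2) + \<epsilon> / 2 * average (\<lambda>x. (v x)\<^sup>2)
      - (1 / 2 * average (\<lambda>x. (?L u x)\<^sup>2) + 1 / 4 * average (\<lambda>x. ((u x)\<^sup>2 - \<epsilon>)\<^sup>2) - 1 / 4 * average (\<lambda>x. \<epsilon>\<^sup>2))
      + (1 / 2 * average (\<lambda>x. (?L w x)\<^sup>2) + 1 / 4 * average (\<lambda>x. ((w x)\<^sup>2 - \<epsilon>)\<^sup>2) - 1 / 4 * average (\<lambda>x. \<epsilon>\<^sup>2))"
  proof (rule has_average_nonneg)
    fix x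
    have "0 \<le> 1 / 4 * ((u x)\<^sup>2 - (w x)\<^sup>2)\<^sup>2 + 1 / 2 * (u x * v x)\<^sup>2"
      by simp
    also have "\<dots> = (?L u x * ?L v x + ((u x) ^ 3 - \<epsilon> * u x) * v x) - 1 / 2 * (?L v x)\<^sup>2 + \<epsilon> / 2 * (v x)\<^sup>2
      - (1 / 2 * (?L u x)\<^sup>2 + 1 / 4 * ((u x)\<^sup>2 - \<epsilon>)\<^sup>2 - 1 / 4 * \<epsilon>\<^sup>2)
      + (1 / 2 * (?L w x)\<^sup>2 + 1 / 4 * ((w x)\<^sup>2 - \<epsilon>)\<^sup>2 - 1 / 4 * \<epsilon>\<^sup>2)"
      unfolding Lv by (simp add: v_def field_simps power2_eq_square power3_eq_cube)
    finally show "0 \<le> \<dots>" .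
  qed
  then have "0 \<le> \<bar>det P\<bar> * ((average (\<lambda>x. ?L u x * ?L v x) + average (\<lambda>x. ((u x) ^ 3 - \<epsilon> * u x) * v x))
      - 1 / 2 * average (\<lambda>x. (?L v x)\<^sup>2) + \<epsilon> / 2 * average (\<lambda>x. (v x)\<^sup>2)
      - (1 / 2 * average (\<lambda>x. (?L u x)\<^sup>2) + 1 / 4 * average (\<lambda>x. ((u x)\<^sup>2 - \<epsilon>)\<^sup>2) - 1 / 4 * average (\<lambda>x. \<epsilon>\<^sup>2))
      + (1 / 2 * average (\<lambda>x. (?L w x)\<^sup>2) + 1 / 4 * average (\<lambda>x. ((w x)\<^sup>2 - \<epsilon>)\<^sup>2) - 1 / 4 * average (\<lambda>x. \<epsilon>\<^sup>2)))"
    by simp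
  then show ?thesis
    unfolding energy_cell[OF u2] energy_cell[OF w(1)] \<mu>_avg by (simp add: algebra_simps)
qed

text \<open>On an eigenfunction of the negative Laplacian with eigenvalue \<open>\<lambda>\<close> this says
  \<open>1 \<le> 3 / (2 * \<lambda>) + (1 - \<lambda>)\<^sup>2\<close>, that is \<open>0 \<le> \<lambda>\<^sup>2 - 2 * \<lambda> + 3 / (2 * \<lambda>)\<close>. The latter expression is
  \<open>(\<lambda> - 4 / 3)\<^sup>2 + 2 / (3 * \<lambda>) * (\<lambda> - 4 / 3)\<^sup>2 + 17 / (54 * \<lambda>)\<close>, and the proof transcribes this
  decomposition: the first square is the one of \<open>laplacian v + 4 / 3 * v\<close>, the second is the Dirichlet
  energy of \<open>v - 4 / 3 * \<psi>\<close>.\<close>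

lemma norm_L2_sq_le_m1_plus_laplacian:
  assumes v: "mean_zero_field v"
  defines "\<psi> \<equiv> inv_neg_laplacian P cell v"
  shows "average (\<lambda>x. (v x)\<^sup>2) \<le> 3 / 2 * average (\<lambda>x. \<psi> x * v x) + average (\<lambda>x. (one_plus_laplacian v x)\<^sup>2)"
proof -
  have \<psi>: "mean_zero_field \<psi>" and lap: "\<And>x. laplacian \<psi> x = - v x"
    using inv_neg_laplacian[OF v] by (auto simp: \<psi>_def)
  have v2: "C_class 2 v" "periodic P v" and \<psi>2: "C_class 2 \<psi>" "periodic P \<psi>"
    using v \<psi> by (auto simp: mean_zero_field_def)
  have lc: "continuous_on UNIV (laplacian v)"
    using C_class_laplacian[of 0] v2 by (auto simp: numeral_2_eq_2)
  note c = C_class_continuous[OF v2(1)] C_class_continuous[OF \<psi>2(1)] lc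
  let ?a = "average (\<lambda>x. \<psi> x * v x)" and ?b = "average (\<lambda>x. (v x)\<^sup>2)"
    and ?d = "average (\<lambda>x. laplacian v x * v x)" and ?e = "average (\<lambda>x. (laplacian v x)\<^sup>2)"
  have a: "0 \<le> ?a"
    using inner_m1_nonneg[OF v] det_nonzero
    by (simp add: inner_m1_eq[OF v c(1)] \<psi>_def zero_le_mult_iff)
  have "has_average (\<lambda>x. (laplacian v x)\<^sup>2 + 8 / 3 * (laplacian v x * v x) + 16 / 9 * (v x)\<^sup>2)
      (?e + 8 / 3 * ?d + 16 / 9 * ?b)"
    by (intro has_average_intros; intro has_averageI continuous_intros c)
  then have sq: "0 \<le> ?e + 8 / 3 * ?d + 16 / 9 * ?b"
  proof (rule has_average_nonneg)
    fix x
    have "0 \<le> (laplacian v x + 4 / 3 * v x)\<^sup>2" by simp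
    then show "0 \<le> (laplacian v x)\<^sup>2 + 8 / 3 * (laplacian v x * v x) + 16 / 9 * (v x)\<^sup>2"
      by (simp add: power2_eq_square algebra_simps)
  qed
  have grad: "?d + 8 / 3 * ?b - 16 / 9 * ?a \<le> 0"
  proof -
    let ?f = "\<lambda>x. 1 * v x + (- 4 / 3) * \<psi> x"
    have "average (\<lambda>x. laplacian v x * \<psi> x) = average (\<lambda>x. v x * laplacian \<psi> x)"
      by (intro average_laplacian_symmetric v2 \<psi>2)
    also have "\<dots> = - ?b"
      using has_average_cmult[OF has_averageI, of "\<lambda>x. (v x)\<^sup>2" "-1"] c
      by (simp add: lap has_average_def power2_eq_square continuous_intros)
    finally have cross: "average (\<lambda>x. laplacian v x * \<psi> x) = - ?b" .
    have "average (\<lambda>x. laplacian ?f x * ?f x) \<le> 0"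
      by (intro average_laplacian_nonpos C_class_lincomb periodic_lincomb v2 \<psi>2)
    moreover have "has_average (\<lambda>x. laplacian v x * v x - 4 / 3 * (laplacian v x * \<psi> x) + 4 / 3 * (v x)\<^sup>2 - 16 / 9 * (\<psi> x * v x))
        (?d - 4 / 3 * average (\<lambda>x. laplacian v x * \<psi> x) + 4 / 3 * ?b - 16 / 9 * ?a)"
      by (intro has_average_intros; intro has_averageI continuous_intros c)
    moreover have "laplacian ?f x * ?f x = laplacian v x * v x - 4 / 3 * (laplacian v x * \<psi> x) + 4 / 3 * (v x)\<^sup>2 - 16 / 9 * (\<psi> x * v x)" for x
      unfolding laplacian_lincomb[OF v2(1) \<psi>2(1)] lap by (simp add: power2_eq_square field_simps)
    ultimately show ?thesis
      using cross by (simp add: has_average_def)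
  qed
  have "has_average (\<lambda>x. (v x)\<^sup>2 + 2 * (laplacian v x * v x) + (laplacian v x)\<^sup>2) (?b + 2 * ?d + ?e)"
    by (intro has_average_intros; intro has_averageI continuous_intros c)
  moreover have "(one_plus_laplacian v x)\<^sup>2 = (v x)\<^sup>2 + 2 * (laplacian v x * v x) + (laplacian v x)\<^sup>2" for x
    by (simp add: one_plus_laplacian_def power2_eq_square algebra_simps)
  ultimately have "average (\<lambda>x. (one_plus_laplacian v x)\<^sup>2) = ?b + 2 * ?d + ?e"
    by (simp add: has_average_def)
  then show ?thesis
    using sq grad a by linarith
qed

end

section \<open>The energy dissipation law\<close>

theorem theorem2p2:
  fixes P :: "real ^ 2 ^ 2" and \<Omega> :: "(real ^ 2) set"
    and k N :: nat and \<epsilon> T \<tau> :: real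
    and \<phi> \<mu> :: "nat \<Rightarrow> real ^ 2 \<Rightarrow> real"
  assumes cell: "periodic_cell P \<Omega>"
    and k: "k \<in> {3, 4, 5}"
    and eps: "0 < \<epsilon>" "\<epsilon> < 1"
    and T: "0 < T" and N: "1 \<le> N" and tau: "\<tau> = T / real N"
    and phi_periodic: "\<And>n. n \<le> N \<Longrightarrow> periodic P (\<phi> n)"
    and phi_start_regular: "\<And>n. n < k \<Longrightarrow> n \<le> N \<Longrightarrow> C_class 2 (\<phi> n)"
    and phi_regular: "\<And>n. k \<le> n \<Longrightarrow> n \<le> N \<Longrightarrow> C_class 4 (\<phi> n)"
    and mu_regular: "\<And>n. k \<le> n \<Longrightarrow> n \<le> N \<Longrightarrow> C_class 2 (\<mu> n)"
    and volume: "\<And>l. 1 \<le> l \<Longrightarrow> l \<le> k - 1 \<Longrightarrow>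
                   inner_L2 \<Omega> (\<phi> l) (\<lambda>_. 1) = inner_L2 \<Omega> (\<phi> 0) (\<lambda>_. 1)"
    and step: "\<tau> \<le> 2 / (3 * \<epsilon>) * min (bdf_kernel k 0) (sigma_L k)"
    and scheme: "\<And>n x. k \<le> n \<Longrightarrow> n \<le> N \<Longrightarrow> BDF k \<tau> \<phi> n x = laplacian (\<mu> n) x"
    and potential: "\<And>n x. k \<le> n \<Longrightarrow> n \<le> N \<Longrightarrow>
                   \<mu> n x = one_plus_laplacian (one_plus_laplacian (\<phi> n)) x + (\<phi> n x) ^ 3 - \<epsilon> * \<phi> n x"
  shows "\<forall>n. k \<le> n \<and> n \<le> N \<longrightarrow>
           modified_energy P \<Omega> \<epsilon> k \<tau> \<phi> n \<le> modified_energy P \<Omega> \<epsilon> k \<tau> \<phi> (n - 1)"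
proof -
  obtain c where \<Omega>: "\<Omega> = (\<lambda>s. c + P *v s) ` {s. \<forall>i. 0 \<le> s $ i \<and> s $ i \<le> 1}" and P: "invertible P"
    using cell unfolding periodic_cell_def by blast
  interpret lattice_cell P c
    using P by unfold_locales
  have "{s :: real ^ 2. \<forall>i. 0 \<le> s $ i \<and> s $ i \<le> 1} = cbox 0 1"
    by (auto simp: mem_box_cart)
  then have \<Omega>_cell: "\<Omega> = local.cell"
    by (simp add: \<Omega> cell_def)
  have \<tau>: "\<tau> > 0"
    using T N tau by simp
  define v where "v = nabla_tau \<phi>"
  have \<phi>2: "C_class 2 (\<phi> j)" if "j \<le> N" for j
    using phi_start_regular[of j] phi_regular[of j] C_class_mono[of 2 4] that by (cases "j < k") auto
  have \<phi>c: "continuous_on UNIV (\<phi> j)" if "j \<le> N" for j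
    using \<phi>2[OF that] by (rule C_class_continuous)
  have v_eq: "v j = (\<lambda>x. 1 * \<phi> j x + (- 1) * \<phi> (j - 1) x)" for j
    by (simp add: v_def nabla_tau_def fun_eq_iff)
  have v2: "C_class 2 (v j)" if "j \<le> N" for j
    unfolding v_eq using that by (intro C_class_lincomb \<phi>2) auto
  have vp: "periodic P (v j)" if "j \<le> N" for j
    unfolding v_eq using that by (intro periodic_lincomb phi_periodic) auto
  have v_avg: "average (v j) = average (\<phi> j) - average (\<phi> (j - 1))" if "j \<le> N" for j
    unfolding v_eq using that by (subst average_lincomb) (auto intro: \<phi>c)
  have start_avg: "average (\<phi> l) = average (\<phi> 0)" if "l < k" "l \<le> N" for l
  proof (cases "l = 0")
    case False
    then have "inner_L2 local.cell (\<phi> l) (\<lambda>_. 1) = inner_L2 local.cell (\<phi> 0) (\<lambda>_. 1)"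
      using volume[of l] that \<Omega>_cell by auto
    then show ?thesis
      using that det_nonzero by (simp add: inner_L2_cell \<phi>c continuous_on_const)
  qed simp
  have scheme': "(\<Sum>i<k. bdf_kernel k i * v (n - i) x) = \<tau> * laplacian (\<mu> n) x" if "k \<le> n" "n \<le> N" for n x
    using scheme[OF that, of x] BDF_eq[OF k that(1), of \<tau> \<phi> x] \<tau> by (simp add: v_def field_simps)
  have \<mu>p: "periodic P (\<mu> n)" if "k \<le> n" "n \<le> N" for n
  proof -
    let ?L = "one_plus_laplacian (\<phi> n)"
    have L: "?L = (\<lambda>x. 1 * \<phi> n x + 1 * laplacian (\<phi> n) x)"
      by (simp add: fun_eq_iff one_plus_laplacian_def)
    have Lp: "periodic P ?L"
      unfolding L by (intro periodic_lincomb periodic_laplacian phi_periodic \<phi>2 that)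
    have L2: "C_class 2 ?L"
      unfolding L using C_class_laplacian[of 2 "\<phi> n"] phi_regular[OF that] \<phi>2[OF that(2)]
      by (intro C_class_lincomb) (simp_all add: numeral_eq_Suc)
    show ?thesis
      using Lp periodic_laplacian[OF L2 Lp] phi_periodic[OF that(2)]
      by (simp add: periodic_def potential[OF that] one_plus_laplacian_def[of ?L])
  qed
  \<comment> \<open>Volume conservation: \<open>laplacian (\<mu> j)\<close> has average zero, so averaging the scheme leaves only
    the newest increment, with the positive coefficient \<open>bdf_kernel k 0\<close>. For \<open>j = 0\<close> the increment is
    zero because \<open>j - 1 = j\<close> on the natural numbers.\<close>
  have increment_avg: "average (v j) = 0" if "j \<le> N" for j
    using that
  proof (induction j rule: less_induct)
    case (less j)
    show ?case
    proof (cases "j < k")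
      case True
      then show ?thesis
        using v_avg[OF less.prems] start_avg[of j] start_avg[of "j - 1"] less.prems by simp
    next
      case False
      then have j: "k \<le> j" by simp
      have k0: "0 < k" using k by auto
      have "has_average (\<lambda>x. \<Sum>i<k. bdf_kernel k i * v (j - i) x) (\<Sum>i<k. bdf_kernel k i * average (v (j - i)))"
        using less.prems by (intro has_average_sum has_average_cmult has_averageI C_class_continuous[OF v2]) simp
      moreover have "has_average (\<lambda>x. \<tau> * laplacian (\<mu> j) x) (\<tau> * average (laplacian (\<mu> j)))"
        using C_class_laplacian[of 0 "\<mu> j"] mu_regular[OF j less.prems]
        by (intro has_average_cmult has_averageI) (simp add: numeral_2_eq_2)
      ultimately have "(\<Sum>i<k. bdf_kernel k i * average (v (j - i))) = 0"
        using average_laplacian[OF mu_regular[OF j less.prems] \<mu>p[OF j less.prems]]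
        by (simp add: has_average_def scheme'[OF j less.prems])
      also have "(\<Sum>i<k. bdf_kernel k i * average (v (j - i))) = (\<Sum>i<k. if i = 0 then bdf_kernel k 0 * average (v j) else 0)"
        using less.IH less.prems j by (intro sum.cong) auto
      also have "\<dots> = bdf_kernel k 0 * average (v j)"
        using k0 by simp
      finally show ?thesis
        using bdf_kernel_0_pos[OF k] by simp
    qed
  qed
  have mz: "mean_zero_field (v j)" if "j \<le> N" for j
    using v2[OF that] vp[OF that] increment_avg[OF that] by (simp add: mean_zero_field_def)
  show ?thesis
  proof (intro allI impI, elim conjE)
    fix n assume n: "k \<le> n" "n \<le> N"
    have n1: "1 \<le> n" using n k by auto
    \<comment> \<open>The increments are counted backwards from \<open>n\<close>, to match the coefficient lists of \<open>gram\<close>.\<close>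
    define w where "w i = v (n - i)" for i
    have w: "mean_zero_field (w i)" for i
      unfolding w_def using n by (intro mz) simp
    define g where "g i j = inner_m1 P local.cell (w i) (w j)" for i j
    let ?sq = "\<lambda>f. (norm_m1 P local.cell f)\<^sup>2"
    have gram: "?sq (\<lambda>x. \<Sum>i<length a. a ! i * w i x) = gram g a" for a
      unfolding g_def by (intro norm_m1_sq_sum w)
    have G_n: "G_functional k ?sq v n = gram_G k (gram g)"
      unfolding G_functional_eq_gram_G[OF k] gram[symmetric] w_def ..
    have G_n1: "G_functional k ?sq v (n - 1) = gram_G k (\<lambda>a. gram g (0 # a))"
    proof -
      have "(\<lambda>x. \<Sum>i<length (0 # a). (0 # a) ! i * w i x) = (\<lambda>x. \<Sum>i<length a. a ! i * v (n - 1 - i) x)" for a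
        unfolding w_def list.size(4) add_0_right add_Suc_right sum.lessThan_Suc_shift by simp
      then show ?thesis
        unfolding G_functional_eq_gram_G[OF k] gram[symmetric] by simp
    qed
    let ?u = "\<phi> n" and ?\<psi> = "inv_neg_laplacian P local.cell (v n)"
    let ?D = "\<bar>det P\<bar>"
    let ?a = "average (\<lambda>x. ?\<psi> x * v n x)" and ?b = "average (\<lambda>x. (v n x)\<^sup>2)"
      and ?l = "average (\<lambda>x. (one_plus_laplacian (v n) x)\<^sup>2)" and ?m = "average (\<lambda>x. \<mu> n x * v n x)"
    have w0: "w 0 = v n" by (simp add: w_def)
    note \<psi> = inv_neg_laplacian[OF mz[OF n(2)]]
    have vc: "continuous_on UNIV (v n)" and \<psi>c: "continuous_on UNIV ?\<psi>"
      using mz[OF n(2)] \<psi>(1) by (auto intro: mean_zero_field_continuous)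
    have g00: "g 0 0 = ?D * ?a"
      unfolding g_def w0 using mz[OF n(2)] vc by (rule inner_m1_eq)
    have D: "?D > 0" using det_nonzero by simp
    have a: "0 \<le> ?a"
      using inner_m1_nonneg[OF mz[OF n(2)]] g00 D by (simp add: g_def w0 zero_le_mult_iff)
    \<comment> \<open>The scheme is tested with the potential of the newest increment.\<close>
    have test: "(\<Sum>i<k. bdf_kernel k i * g 0 i) = - \<tau> * (?D * ?m)"
    proof -
      have lc: "continuous_on UNIV (laplacian (\<mu> n))"
        using C_class_laplacian[of 0 "\<mu> n"] mu_regular[OF n] by (simp add: numeral_2_eq_2)
      have "(\<Sum>i<k. bdf_kernel k i * g 0 i) = inner_m1 P local.cell (v n) (\<lambda>x. \<Sum>i<k. bdf_kernel k i * w i x)"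
        unfolding g_def w0 by (intro inner_m1_sum_right[symmetric] mz n w)
      also have "(\<lambda>x. \<Sum>i<k. bdf_kernel k i * w i x) = (\<lambda>x. \<tau> * laplacian (\<mu> n) x)"
        unfolding w_def scheme'[OF n] ..
      also have "inner_m1 P local.cell (v n) \<dots> = ?D * average (\<lambda>x. ?\<psi> x * (\<tau> * laplacian (\<mu> n) x))"
        by (intro inner_m1_eq mz n continuous_intros lc)
      also have "average (\<lambda>x. ?\<psi> x * (\<tau> * laplacian (\<mu> n) x)) = \<tau> * average (\<lambda>x. ?\<psi> x * laplacian (\<mu> n) x)"
        using has_average_cmult[OF has_averageI[OF continuous_on_mult[OF \<psi>c lc]], of \<tau>]
        by (simp add: has_average_def ac_simps)
      also have "average (\<lambda>x. ?\<psi> x * laplacian (\<mu> n) x) = average (\<lambda>x. laplacian ?\<psi> x * \<mu> n x)"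
        using \<psi>(1) \<mu>p[OF n] mu_regular[OF n]
        by (intro average_laplacian_symmetric[symmetric]) (auto simp: mean_zero_field_def)
      also have "\<dots> = - ?m"
        using has_average_cmult[OF has_averageI[OF continuous_on_mult[OF C_class_continuous[OF mu_regular[OF n]] vc]], of "-1"]
        by (simp add: has_average_def \<psi>(2) ac_simps)
      finally show ?thesis by simp
    qed
    have "gram_G k (gram g) - gram_G k (\<lambda>a. gram g (0 # a)) + sigma_L k / 2 * g 0 0 \<le> (\<Sum>i<k. bdf_kernel k i * g 0 i)"
    proof (rule bdf_gradient_structure[OF k])
      show "g i j = g j i" for i j
        unfolding g_def by (intro inner_m1_symmetric w)
      show "0 \<le> gram g a" for a
        unfolding gram[symmetric] by simp
    qed
    then have "gram_G k (gram g) - gram_G k (\<lambda>a. gram g (0 # a)) \<le> ?D * (- \<tau> * ?m - sigma_L k / 2 * ?a)"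
      unfolding test g00 by (simp add: algebra_simps)
    then have "1 / \<tau> * (gram_G k (gram g) - gram_G k (\<lambda>a. gram g (0 # a))) \<le> 1 / \<tau> * (?D * (- \<tau> * ?m - sigma_L k / 2 * ?a))"
      using \<tau> by (intro mult_left_mono) auto
    also have "\<dots> = ?D * (- ?m - sigma_L k / \<tau> / 2 * ?a)"
      using \<tau> by (simp add: field_simps)
    also have "\<dots> \<le> ?D * (- ?m - 3 / 4 * \<epsilon> * ?a)"
    proof -
      have "\<tau> \<le> 2 / (3 * \<epsilon>) * sigma_L k"
        using step eps by (smt (verit) divide_nonneg_nonneg min.cobounded2 mult_left_mono)
      then have "3 / 2 * \<epsilon> \<le> sigma_L k / \<tau>"
        using \<tau> eps by (simp add: field_simps)
      from divide_right_mono[OF this, of 2] have "3 / 4 * \<epsilon> \<le> sigma_L k / \<tau> / 2"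
        by simp
      from mult_right_mono[OF this a] have "3 / 4 * \<epsilon> * ?a \<le> sigma_L k / \<tau> / 2 * ?a" .
      then show ?thesis
        using D by (intro mult_left_mono) auto
    qed
    finally have dG: "1 / \<tau> * (gram_G k (gram g) - gram_G k (\<lambda>a. gram g (0 # a))) \<le> ?D * (- ?m - 3 / 4 * \<epsilon> * ?a)" .
    have vn: "\<phi> n x - \<phi> (n - 1) x = v n x" for x
      by (simp add: v_eq)
    have dE: "energy local.cell \<epsilon> (\<phi> n) - energy local.cell \<epsilon> (\<phi> (n - 1)) \<le> ?D * (?m - 1 / 2 * ?l + \<epsilon> / 2 * ?b)"
      using energy_difference_le[OF phi_regular[OF n] phi_periodic[OF n(2)] \<phi>2[of "n - 1"] phi_periodic[of "n - 1"]
          potential[OF n]] n unfolding vn by simp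
    have "?m - 1 / 2 * ?l + \<epsilon> / 2 * ?b + (- ?m - 3 / 4 * \<epsilon> * ?a) \<le> 0"
    proof -
      have "\<epsilon> * ?b \<le> \<epsilon> * (3 / 2 * ?a + ?l)"
        using norm_L2_sq_le_m1_plus_laplacian[OF mz[OF n(2)]] eps by (intro mult_left_mono) auto
      moreover have "\<epsilon> * ?l \<le> 1 * ?l"
        using eps continuous_one_plus_laplacian[OF v2[OF n(2)]]
        by (intro mult_right_mono average_nonneg continuous_intros) auto
      ultimately show ?thesis
        by (simp add: algebra_simps)
    qed
    then have "?D * (?m - 1 / 2 * ?l + \<epsilon> / 2 * ?b + (- ?m - 3 / 4 * \<epsilon> * ?a)) \<le> 0"
      using D by (intro mult_nonneg_nonpos) auto
    then have "energy local.cell \<epsilon> (\<phi> n) - energy local.cell \<epsilon> (\<phi> (n - 1))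
        + 1 / \<tau> * (gram_G k (gram g) - gram_G k (\<lambda>a. gram g (0 # a))) \<le> 0"
      using dE dG by (simp add: algebra_simps)
    then show "modified_energy P \<Omega> \<epsilon> k \<tau> \<phi> n \<le> modified_energy P \<Omega> \<epsilon> k \<tau> \<phi> (n - 1)"
      unfolding modified_energy_def \<Omega>_cell v_def[symmetric] G_n G_n1 by (simp add: algebra_simps)
  qed
qed

end
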